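(* $k$-Star Transversal can be approximated within a factor of $O(\log k)$ in polynomial time.
   Context: $k$-Star denotes the complete bipartite graph $K_{1,k-1}$. For an undirected graph $G=(V_G,E_G)$, $k$-Star Transversal asks for a smallest set $F\subseteq V_G$ such that the subgraph of $G$ induced by $V_G\setminus F$ contains no subgraph isomorphic to $K_{1,k-1}$ (equivalently, the induced subgraph on $V_G\setminus F$ has maximum degree at most $k-2$). *)

theory Defs
  imports
    Complex_Main
    "HOL-Library.Landau_Symbols"
    "HOL-Library.Log_Nat"
    "HOL-Computational_Algebra.Polynomial"
    "Graph_Theory.Graph_Theory"
begin

section \<open>Star transversals\<close>

text \<open>
  As in \<^theory>\<open>Graph_Theory.Graph_Theory\<close>, a finite simple undirected graph is a symmetric digraph
  without loops and parallel arcs. The predicate \<^term>\<open>K\<^bsub>1,k - 1\<^esub> H\<close> is invariant under isomorphism,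
  so a subgraph satisfying it is a subgraph isomorphic to the star with \<^term>\<open>k - 1\<close> leaves.
\<close>

definition star_transversal :: "nat \<Rightarrow> ('a, 'b) pre_digraph \<Rightarrow> 'a set \<Rightarrow> bool" where
  "star_transversal k G F \<longleftrightarrow>
     F \<subseteq> verts G \<and> \<not> (\<exists>H. subgraph H (G \<restriction> (verts G - F)) \<and> K\<^bsub>1,k - 1\<^esub> H)"

definition opt_star_transversal :: "nat \<Rightarrow> ('a, 'b) pre_digraph \<Rightarrow> nat" where
  "opt_star_transversal k G = (LEAST m. \<exists>F. star_transversal k G F \<and> card F = m)"

section \<open>Polynomial time on random access machines\<close>

text \<open>
  Structured programs for the random access machine with input and output tapes. The registers are
  indexed by the natural numbers, hold natural numbers and are all zero initially. The input is a
  read-only sequence of numbers with random access; the output is written sequentially.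

  Every elementary operation and every test costs one time unit. There is no multiplication, so
  within \<open>t\<close> steps the bit length of the largest number grows by at most \<open>t\<close> plus a constant;
  therefore polynomial time on this machine coincides with polynomial time on Turing machines
  (for multiplication at unit cost this would fail).
\<close>

datatype com =
    Skip
  | Const nat nat
  | Add nat nat nat
  | Sub nat nat nat
  | Load nat nat
  | Store nat nat
  | Read nat nat
  | Write nat
  | Seq com com
  | Cond nat com com
  | While nat com

type_synonym state = "(nat \<Rightarrow> nat) \<times> nat list"

text \<open>
  \<open>exec xs c s t s'\<close>: on input \<open>xs\<close>, the program \<open>c\<close> started in state \<open>s\<close> terminates after \<open>t\<close> steps
  in state \<open>s'\<close>. Tests succeed on nonzero registers; subtraction is truncated at zero.
\<close>

inductive exec :: "nat list \<Rightarrow> com \<Rightarrow> state \<Rightarrow> nat \<Rightarrow> state \<Rightarrow> bool" for xs where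
  Skip: "exec xs Skip s 1 s"
| Const: "exec xs (Const r n) (M, out) 1 (M(r := n), out)"
| Add: "exec xs (Add r a b) (M, out) 1 (M(r := M a + M b), out)"
| Sub: "exec xs (Sub r a b) (M, out) 1 (M(r := M a - M b), out)"
| Load: "exec xs (Load r a) (M, out) 1 (M(r := M (M a)), out)"
| Store: "exec xs (Store r a) (M, out) 1 (M(M r := M a), out)"
| Read: "exec xs (Read r a) (M, out) 1
           (M(r := (if M a < length xs then xs ! M a else 0)), out)"
| Write: "exec xs (Write a) (M, out) 1 (M, out @ [M a])"
| Seq: "exec xs c1 s t1 s' \<Longrightarrow> exec xs c2 s' t2 s'' \<Longrightarrow> exec xs (Seq c1 c2) s (t1 + t2) s''"
| CondTrue: "fst s a \<noteq> 0 \<Longrightarrow> exec xs c1 s t s' \<Longrightarrow> exec xs (Cond a c1 c2) s (1 + t) s'"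
| CondFalse: "fst s a = 0 \<Longrightarrow> exec xs c2 s t s' \<Longrightarrow> exec xs (Cond a c1 c2) s (1 + t) s'"
| WhileFalse: "fst s a = 0 \<Longrightarrow> exec xs (While a c) s 1 s"
| WhileTrue: "fst s a \<noteq> 0 \<Longrightarrow> exec xs c s t1 s' \<Longrightarrow> exec xs (While a c) s' t2 s'' \<Longrightarrow>
                exec xs (While a c) s (1 + t1 + t2) s''"

inductive_cases SeqE: "exec xs (Seq c1 c2) s t s'"
inductive_cases CondE: "exec xs (Cond a c1 c2) s t s'"
inductive_cases WhileE: "exec xs (While a c) s t s'"

lemma exec_deterministic:
  "exec xs c s t s' \<Longrightarrow> exec xs c s u s'' \<Longrightarrow> u = t \<and> s'' = s'"
proof (induction arbitrary: u s'' rule: exec.induct)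
  case (Seq c1 s t1 s1 c2 t2 s2)
  from Seq.prems obtain u1 v u2 where "u = u1 + u2" "exec xs c1 s u1 v" "exec xs c2 v u2 s''"
    by (rule SeqE)
  with Seq.IH(1)[of u1 v] Seq.IH(2)[of u2 s''] show ?case by simp
next
  case (CondTrue s a c1 t s1 c2)
  from CondTrue.prems obtain u1 where "u = 1 + u1" "exec xs c1 s u1 s''"
    by (rule CondE) (use CondTrue.hyps in simp_all)
  with CondTrue.IH[of u1 s''] show ?case by simp
next
  case (CondFalse s a c2 t s1 c1)
  from CondFalse.prems obtain u1 where "u = 1 + u1" "exec xs c2 s u1 s''"
    by (rule CondE) (use CondFalse.hyps in simp_all)
  with CondFalse.IH[of u1 s''] show ?case by simp
next
  case (WhileFalse s a c)
  from WhileFalse.prems show ?case by (rule WhileE) (use WhileFalse.hyps in simp_all)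
next
  case (WhileTrue s a c t1 s1 t2 s2)
  from WhileTrue.prems obtain u1 v u2
    where "u = 1 + u1 + u2" "exec xs c s u1 v" "exec xs (While a c) v u2 s''"
    by (rule WhileE) (use WhileTrue.hyps in simp_all)
  with WhileTrue.IH(1)[of u1 v] WhileTrue.IH(2)[of u2 s''] show ?case by simp
qed (erule exec.cases; simp)+

text \<open>The size of an input is the total length of the binary representations of its entries.\<close>

definition input_size :: "nat list \<Rightarrow> nat" where
  "input_size xs = (\<Sum>x\<leftarrow>xs. max 1 (floorlog 2 x))"

text \<open>
  The program \<open>c\<close> solves, in time polynomial in the input size, the search problem with instances
  \<open>I\<close>, encoded by \<open>enc\<close>, where \<open>R i ys\<close> states that \<open>ys\<close> is an admissible output for \<open>i\<close>.
\<close>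

definition solves_in_poly_time ::
    "com \<Rightarrow> 'i set \<Rightarrow> ('i \<Rightarrow> nat list) \<Rightarrow> ('i \<Rightarrow> nat list \<Rightarrow> bool) \<Rightarrow> bool" where
  "solves_in_poly_time c I enc R \<longleftrightarrow>
     (\<exists>p :: nat poly. \<forall>i\<in>I. \<exists>t M ys.
        exec (enc i) c ((\<lambda>_. 0), []) t (M, ys) \<and> t \<le> poly p (input_size (enc i)) \<and> R i ys)"

section \<open>Star transversal as an algorithmic problem\<close>

definition star_instances :: "(nat \<times> nat pair_pre_digraph) set" where
  "star_instances = {(k, G). k \<ge> 2 \<and> pair_graph G \<and> (\<exists>n. pverts G = {..<n})}"

text \<open>
  The number of vertices, then \<open>k\<close>, then the adjacency matrix row by row.
\<close>

definition encode_instance :: "nat \<times> nat pair_pre_digraph \<Rightarrow> nat list" where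
  "encode_instance = (\<lambda>(k, G). let n = card (pverts G) in
     n # k # [if (i, j) \<in> parcs G then 1 else 0. i \<leftarrow> [0..<n], j \<leftarrow> [0..<n]])"

text \<open>The output lists the vertices of the transversal; repetitions are harmless.\<close>

definition approx_star_transversal ::
    "(nat \<Rightarrow> real) \<Rightarrow> nat \<times> nat pair_pre_digraph \<Rightarrow> nat list \<Rightarrow> bool" where
  "approx_star_transversal \<rho> = (\<lambda>(k, G) ys.
     star_transversal k (with_proj G) (set ys) \<and>
     real (card (set ys)) \<le> \<rho> k * real (opt_star_transversal k (with_proj G)))"

end

theory Submission
  imports Defs
begin

text \<open>
  Write \<open>d = k - 2\<close> for the permitted degree. The algorithm combines local ratio with greedy
  multicovering (Okun and Barak).

  As long as some live vertex \<open>v\<close> has \<open>D > 2 d\<close> live neighbours, \<open>v\<close> is charged \<open>D\<close> and each of these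
  neighbours is charged 1; vertices whose charge reaches \<open>n\<close> die. An optimal solution receives at
  least \<open>D - d \<ge> D / 2\<close> of the \<open>2 D\<close> units, and no vertex ever carries more than \<open>2 n\<close> units, so at
  most \<open>8 opt\<close> vertices die. Charges count upwards by integers instead of subtracting from rational
  weights, which suits a machine without multiplication.

  In the rest all degrees are at most \<open>2 d\<close>, so a vertex covers at most \<open>3 d\<close> units of the total
  excess degree, and greedy removal costs at most \<open>(1 + H(3 d)) opt\<close>. Greedy is implemented by a
  threshold \<open>\<tau>\<close> that is lowered from \<open>2 n\<close> to 1: coverage only shrinks under removals, so one pass over the
  vertices per threshold suffices.
\<close>


section \<open>Excess degree and coverage\<close>

definition nbrs :: "'a rel \<Rightarrow> 'a set \<Rightarrow> 'a \<Rightarrow> 'a set" where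
  "nbrs E S v = {u \<in> S. (v, u) \<in> E}"

definition deg :: "'a rel \<Rightarrow> 'a set \<Rightarrow> 'a \<Rightarrow> nat" where
  "deg E S v = card (nbrs E S v)"

definition excess :: "'a rel \<Rightarrow> nat \<Rightarrow> 'a set \<Rightarrow> nat" where
  "excess E d S = (\<Sum>v\<in>S. deg E S v - d)"

text \<open>The amount of excess that disappears with \<open>u\<close>: its own excess plus one unit
  for each neighbour that is still above degree \<open>d\<close>.\<close>

definition cov :: "'a rel \<Rightarrow> nat \<Rightarrow> 'a set \<Rightarrow> 'a \<Rightarrow> nat" where
  "cov E d S u = deg E S u - d + card {v \<in> nbrs E S u. d < deg E S v}"

definition bounded_deg :: "'a rel \<Rightarrow> nat \<Rightarrow> 'a set \<Rightarrow> bool" where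
  "bounded_deg E d S \<longleftrightarrow> (\<forall>v\<in>S. deg E S v \<le> d)"

lemma finite_nbrs: "finite S \<Longrightarrow> finite (nbrs E S v)"
  by (simp add: nbrs_def)

lemma deg_mono: "finite T \<Longrightarrow> S \<subseteq> T \<Longrightarrow> deg E S v \<le> deg E T v"
  unfolding deg_def nbrs_def by (rule card_mono) auto

lemma bounded_deg_subset:
  "finite T \<Longrightarrow> S \<subseteq> T \<Longrightarrow> bounded_deg E d T \<Longrightarrow> bounded_deg E d S"
  unfolding bounded_deg_def by (meson deg_mono order_trans subsetD)

lemma cov_mono:
  assumes "finite T" "S \<subseteq> T" shows "cov E d S u \<le> cov E d T u"
proof -
  have "card {v \<in> nbrs E S u. d < deg E S v} \<le> card {v \<in> nbrs E T u. d < deg E T v}"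
    using assms deg_mono[OF assms]
    by (intro card_mono) (auto simp: nbrs_def intro: less_le_trans)
  then show ?thesis
    unfolding cov_def using deg_mono[OF assms, of E u] by linarith
qed

text \<open>At most \<open>d\<close> neighbours of a surviving vertex may survive, so the others lie
  in \<open>X\<close>. Both phases draw their lower bound on feasible sets from this count.\<close>

lemma deg_le_outside:
  assumes "finite S" "bounded_deg E d (S - X)" "v \<in> S - X"
  shows "deg E S v \<le> d + card (nbrs E S v \<inter> X)"
proof -
  have "nbrs E S v = nbrs E (S - X) v \<union> (nbrs E S v \<inter> X)"
    by (auto simp: nbrs_def)
  then have "deg E S v \<le> deg E (S - X) v + card (nbrs E S v \<inter> X)"
    unfolding deg_def by (metis card_Un_le)
  moreover have "deg E (S - X) v \<le> d" using assms by (auto simp: bounded_deg_def)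
  ultimately show ?thesis by linarith
qed

text \<open>A feasible set must use up the excess of every vertex, by removing either it or its neighbours.\<close>

lemma excess_le_sum_cov:
  assumes "finite S" "sym E" "bounded_deg E d (S - X)"
  shows "excess E d S \<le> (\<Sum>u\<in>S \<inter> X. cov E d S u)"
proof -
  let ?P = "\<lambda>v. d < deg E S v"
  let ?D = "\<lambda>v. deg E S v - d"
  \<comment> \<open>A vertex of \<open>X\<close> accounts for its excess itself; any other vertex
    needs at least that many neighbours in \<open>X\<close>.\<close>
  have le: "?D v \<le> (if v \<in> X then ?D v else 0) + (if ?P v then card (nbrs E S v \<inter> X) else 0)"
    if "v \<in> S" for v
    using deg_le_outside[OF assms(1,3), of v] that by (cases "v \<in> X") auto
  have card_sum: "card {v \<in> A. Q v} = (\<Sum>v\<in>A. if Q v then 1 else 0)" if "finite A" for A :: "'a set" and Q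
    using that by (simp add: sum.If_cases Int_def)
  \<comment> \<open>Double counting of the edges between \<open>X\<close> and the vertices above
    degree \<open>d\<close>; symmetry of \<open>E\<close> allows counting from either end.\<close>
  have "(\<Sum>u\<in>S \<inter> X. card {v \<in> nbrs E S u. ?P v})
      = (\<Sum>u\<in>S \<inter> X. \<Sum>v\<in>S. if (u, v) \<in> E \<and> ?P v then 1 else 0)"
  proof (intro sum.cong refl)
    fix u
    have "{v \<in> nbrs E S u. ?P v} = {v \<in> S. (u, v) \<in> E \<and> ?P v}" by (auto simp: nbrs_def)
    then show "card {v \<in> nbrs E S u. ?P v} = (\<Sum>v\<in>S. if (u, v) \<in> E \<and> ?P v then 1 else 0)"
      by (simp only: card_sum[OF assms(1)])
  qed
  also have "\<dots> = (\<Sum>v\<in>S. \<Sum>u\<in>S \<inter> X. if (u, v) \<in> E \<and> ?P v then 1 else 0)"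
    by (rule sum.swap)
  also have "\<dots> = (\<Sum>v\<in>S. if ?P v then card (nbrs E S v \<inter> X) else 0)"
  proof (intro sum.cong refl)
    fix v
    have "nbrs E S v \<inter> X = {u \<in> S \<inter> X. (u, v) \<in> E}"
      using \<open>sym E\<close> by (auto simp: nbrs_def sym_def)
    then show "(\<Sum>u\<in>S \<inter> X. if (u, v) \<in> E \<and> ?P v then 1 else 0)
        = (if ?P v then card (nbrs E S v \<inter> X) else 0)"
      using card_sum[of "S \<inter> X" "\<lambda>u. (u, v) \<in> E"] assms(1) by simp
  qed
  finally have swap: "(\<Sum>u\<in>S \<inter> X. card {v \<in> nbrs E S u. ?P v})
      = (\<Sum>v\<in>S. if ?P v then card (nbrs E S v \<inter> X) else 0)" .
  have "excess E d S \<le> (\<Sum>v\<in>S. (if v \<in> X then ?D v else 0) + (if ?P v then card (nbrs E S v \<inter> X) else 0))"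
    unfolding excess_def by (intro sum_mono le)
  also have "\<dots> = (\<Sum>u\<in>S \<inter> X. ?D u) + (\<Sum>v\<in>S. if ?P v then card (nbrs E S v \<inter> X) else 0)"
    using assms(1) by (simp add: sum.distrib sum.inter_restrict)
  also have "\<dots> = (\<Sum>u\<in>S \<inter> X. cov E d S u)"
    unfolding swap[symmetric] cov_def by (simp add: sum.distrib)
  finally show ?thesis .
qed

text \<open>The summand of \<open>u\<close> vanishes, and each neighbour counted by
  \<open>cov\<close> loses one degree while above \<open>d\<close>, where truncated subtraction
  really drops. Irreflexivity keeps \<open>u\<close> out of its own neighbourhood, so the two
  contributions are separate.\<close>

lemma excess_remove:
  assumes "finite S" "sym E" "irrefl E" "u \<in> S"
  shows "excess E d (S - {u}) + cov E d S u \<le> excess E d S"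
proof -
  let ?N = "{v \<in> nbrs E S u. d < deg E S v}"
  have N: "?N \<subseteq> S - {u}" using assms(3) by (auto simp: nbrs_def irrefl_def)
  have le: "deg E (S - {u}) v - d + (if v \<in> ?N then 1 else 0) \<le> deg E S v - d" if "v \<in> S - {u}" for v
  proof (cases "v \<in> ?N")
    case True
    then have "u \<in> nbrs E S v" using assms by (auto simp: nbrs_def sym_def)
    moreover have "nbrs E (S - {u}) v = nbrs E S v - {u}" by (auto simp: nbrs_def)
    ultimately have "deg E (S - {u}) v < deg E S v"
      unfolding deg_def using assms(1)
      by (metis card_Diff1_less finite_nbrs)
    moreover have "d < deg E S v" using True by simp
    ultimately show ?thesis using True by simp
  next
    case False
    then show ?thesis using deg_mono[of S "S - {u}" E v] assms(1) by auto
  qed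
  have "excess E d (S - {u}) + card ?N
      = (\<Sum>v\<in>S - {u}. deg E (S - {u}) v - d + (if v \<in> ?N then 1 else 0))"
  proof -
    have "(S - {u}) \<inter> {v. v \<in> ?N} = ?N" using N by blast
    then show ?thesis using assms(1) by (simp only: excess_def sum.distrib sum.If_cases finite_Diff) simp
  qed
  also have "\<dots> \<le> (\<Sum>v\<in>S - {u}. deg E S v - d)"
    by (intro sum_mono le)
  finally show ?thesis
    unfolding cov_def using assms(1,4) by (simp add: excess_def sum.remove[of S u])
qed

lemma bounded_deg_if_cov_0:
  "\<forall>u\<in>S. cov E d S u = 0 \<Longrightarrow> bounded_deg E d S"
  by (auto simp: cov_def bounded_deg_def)

section \<open>Charging\<close>

text \<open>The charge array doubles as the deletion mark: in both phases a charge of at least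
  \<open>n\<close> means removed.\<close>

definition alive :: "nat \<Rightarrow> (nat \<Rightarrow> nat) \<Rightarrow> nat set" where
  "alive n c = {u. u < n \<and> c u < n}"

definition charge :: "nat rel \<Rightarrow> nat \<Rightarrow> nat \<Rightarrow> nat \<Rightarrow> (nat \<Rightarrow> nat) \<Rightarrow> nat \<Rightarrow> nat" where
  "charge E d n v c =
     (if v \<in> alive n c \<and> 2 * d < deg E (alive n c) v
      then (\<lambda>u. if u = v then c v + deg E (alive n c) v
                else if u \<in> nbrs E (alive n c) v then c u + 1 else c u)
      else c)"

text \<open>A round that does not apply is the identity, and an effective one raises the charge of
  \<open>v\<close> by at least 1. Hence a fixed number of \<open>n\<close> rounds per vertex
  replaces a loop with a stopping condition.\<close>

definition charge_all :: "nat rel \<Rightarrow> nat \<Rightarrow> nat \<Rightarrow> (nat \<Rightarrow> nat) \<Rightarrow> nat \<Rightarrow> nat" where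
  "charge_all E d n = fold (\<lambda>v. charge E d n v ^^ n) [0..<n]"

lemma upt_split: "u < n \<Longrightarrow> [0..<n] = [0..<u] @ u # [Suc u..<n]"
  using upt_add_eq_append[of 0 u "n - u"] upt_conv_Cons[of u n] by simp

lemma alive_subset: "alive n c \<subseteq> {..<n}" and finite_alive: "finite (alive n c)"
  by (auto simp: alive_def)

lemma card_alive: "card (alive n c) \<le> n"
  using card_mono[OF _ alive_subset[of n c]] by simp

lemma deg_alive: "irrefl E \<Longrightarrow> v \<in> alive n c \<Longrightarrow> deg E (alive n c) v \<le> n"
  using card_mono[of "alive n c" "nbrs E (alive n c) v"] card_alive[of n c] finite_alive[of n c]
  by (auto simp: deg_def nbrs_def)

lemma charge_ge: "c u \<le> charge E d n v c u"
  by (auto simp: charge_def)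

lemma alive_mono: "(\<And>u. c u \<le> c' u) \<Longrightarrow> alive n c' \<subseteq> alive n c"
  by (auto simp: alive_def intro: le_less_trans)

definition charge_inv :: "nat \<Rightarrow> nat set \<Rightarrow> (nat \<Rightarrow> nat) \<Rightarrow> bool" where
  "charge_inv n X c \<longleftrightarrow> (\<forall>u<n. c u \<le> 2 * n) \<and> (\<Sum>u<n. c u) \<le> 4 * (\<Sum>u\<in>X. c u)"

text \<open>If \<open>v\<close> lies in \<open>X\<close>, then \<open>X\<close> receives the
  \<open>D\<close> units put on \<open>v\<close>. Otherwise at least \<open>D - d\<close> neighbours
  of \<open>v\<close> lie in \<open>X\<close>, which exceeds \<open>D / 2\<close> because
  \<open>2 * d < D\<close>. The round spends \<open>2 * D\<close> units in all, so the factor 4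
  persists.\<close>

lemma charge_inv_step:
  assumes "sym E" "irrefl E" "X \<subseteq> {..<n}" "bounded_deg E d ({..<n} - X)" "charge_inv n X c"
  shows "charge_inv n X (charge E d n v c)"
proof (cases "v \<in> alive n c \<and> 2 * d < deg E (alive n c) v")
  case False
  then have "charge E d n v c = c" by (auto simp: charge_def)
  with assms(5) show ?thesis by simp
next
  case True
  define S where "S = alive n c"
  define N where "N = nbrs E S v"
  define D where "D = deg E S v"
  have S: "finite S" "S \<subseteq> {..<n}" unfolding S_def by (rule finite_alive, rule alive_subset)
  have v: "v \<in> S" "v < n" "c v < n" "2 * d < D" using True by (auto simp: S_def alive_def D_def)
  have N: "v \<notin> N" "N \<subseteq> S" "card N = D" "finite N"
    using assms(2) S by (auto simp: N_def nbrs_def irrefl_def D_def deg_def)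
  have c': "charge E d n v c = (\<lambda>u. c u + ((if u = v then D else 0) + (if u \<in> N then 1 else 0)))"
    using True N(1) by (auto simp: charge_def S_def N_def D_def fun_eq_iff)
  have sum_c': "(\<Sum>u\<in>A. charge E d n v c u) = (\<Sum>u\<in>A. c u) + ((if v \<in> A then D else 0) + card (N \<inter> A))"
    if "A \<subseteq> {..<n}" for A
  proof -
    have "finite A" using that finite_subset by blast
    then have "(\<Sum>u\<in>A. if u \<in> N then 1 else 0 :: nat) = card (N \<inter> A)"
      by (simp add: sum.If_cases Int_commute)
    with \<open>finite A\<close> show ?thesis by (simp add: c' sum.distrib)
  qed
  \<comment> \<open>Only live vertices are charged: they hold less than \<open>n\<close> and gain at
    most \<open>D\<close>, which is at most \<open>n\<close>.\<close>
  have le: "charge E d n v c u \<le> 2 * n" if "u < n" for u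
  proof -
    have "D \<le> n" using deg_alive[OF assms(2), of v n c] v by (simp add: D_def S_def)
    moreover have "u \<in> N \<Longrightarrow> c u < n" using N(2) by (auto simp: S_def alive_def)
    ultimately show ?thesis using v N(1) assms(5) that by (auto simp: c' charge_inv_def)
  qed
  have "N \<inter> {..<n} = N" using N S by auto
  then have total: "(\<Sum>u<n. charge E d n v c u) = (\<Sum>u<n. c u) + 2 * D"
    using sum_c'[of "{..<n}"] v N by simp
  have "D \<le> d + card (N \<inter> X)" if "v \<notin> X"
    unfolding D_def N_def
    using deg_le_outside[OF S(1), of E d X v] bounded_deg_subset[OF _ _ assms(4), of "S - X"] S v that
    by auto
  then have "2 * D \<le> 4 * ((if v \<in> X then D else 0) + card (N \<inter> X))"
    using v by (cases "v \<in> X") auto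
  then have "(\<Sum>u<n. charge E d n v c u) \<le> 4 * (\<Sum>u\<in>X. charge E d n v c u)"
    unfolding total sum_c'[OF assms(3)] using assms(5) unfolding charge_inv_def distrib_left by simp
  with le show ?thesis by (simp add: charge_inv_def)
qed

lemma charge_inv_charge_all:
  assumes "sym E" "irrefl E" "X \<subseteq> {..<n}" "bounded_deg E d ({..<n} - X)" "charge_inv n X c"
  shows "charge_inv n X (charge_all E d n c)"
proof -
  have pow: "charge_inv n X c \<Longrightarrow> charge_inv n X ((charge E d n v ^^ j) c)" for v j c
    by (induction j) (auto intro: charge_inv_step[OF assms(1-4)])
  have "charge_inv n X c \<Longrightarrow> charge_inv n X (fold (\<lambda>v. charge E d n v ^^ n) vs c)" for vs c
    by (induction vs arbitrary: c) (auto intro: pow)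
  then show ?thesis using assms(5) by (simp add: charge_all_def)
qed

text \<open>Each dead vertex carries a charge of at least \<open>n\<close>, and the vertices of \<open>X\<close> at most \<open>2 n\<close> each.\<close>

lemma card_dead_le:
  assumes "X \<subseteq> {..<n}" "charge_inv n X c"
  shows "card ({..<n} - alive n c) \<le> 8 * card X"
proof (cases "n = 0")
  case False
  have "card ({..<n} - alive n c) * n = (\<Sum>u\<in>{..<n} - alive n c. n)" by simp
  also have "\<dots> \<le> (\<Sum>u\<in>{..<n} - alive n c. c u)" by (intro sum_mono) (auto simp: alive_def)
  also have "\<dots> \<le> (\<Sum>u<n. c u)" by (intro sum_mono2) auto
  also have "\<dots> \<le> 4 * (\<Sum>u\<in>X. c u)" using assms(2) by (simp add: charge_inv_def)
  also have "\<dots> \<le> 4 * (\<Sum>u\<in>X. 2 * n)"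
    using assms by (intro mult_left_mono sum_mono) (auto simp: charge_inv_def)
  also have "\<dots> = (8 * card X) * n" by simp
  finally show ?thesis using False by (simp only: mult_le_cancel2)
qed simp

section \<open>Low degrees among the survivors of charging\<close>

definition settled :: "nat rel \<Rightarrow> nat \<Rightarrow> nat \<Rightarrow> nat \<Rightarrow> (nat \<Rightarrow> nat) \<Rightarrow> bool" where
  "settled E d n v c \<longleftrightarrow> (v \<in> alive n c \<longrightarrow> deg E (alive n c) v \<le> 2 * d)"

text \<open>Growing charges shrink the live set and with it all degrees, so treating later vertices
  cannot undo the work done for earlier ones.\<close>

lemma settled_mono:
  "(\<And>u. c u \<le> c' u) \<Longrightarrow> settled E d n v c \<Longrightarrow> settled E d n v c'"
  using deg_mono[OF finite_alive alive_mono[of c c' n], of E v] alive_mono[of c c' n]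
  by (force simp: settled_def)

lemma charge_pow_ge: "c u \<le> (charge E d n v ^^ j) c u"
proof (induction j)
  case (Suc j)
  then show ?case using charge_ge[of "(charge E d n v ^^ j) c" u E d n v] by simp
qed simp

text \<open>Progress per round: an unsettled vertex has positive degree and adds it to its own
  charge. After \<open>n\<close> rounds the second alternative makes \<open>v\<close> dead, and dead
  vertices are settled vacuously.\<close>

lemma settled_charge_pow:
  "settled E d n v ((charge E d n v ^^ j) c) \<or> c v + j \<le> (charge E d n v ^^ j) c v"
proof (induction j)
  case (Suc j)
  let ?c = "(charge E d n v ^^ j) c"
  show ?case
  proof (cases "settled E d n v ?c")
    case True
    then show ?thesis using settled_mono[of _ "charge E d n v ?c", OF charge_ge] by simp
  next
    case False
    then have "charge E d n v ?c v > ?c v" by (auto simp: settled_def charge_def)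
    with Suc False show ?thesis by auto
  qed
qed simp

lemma settled_charge_all:
  assumes "v < n" shows "settled E d n v (charge_all E d n c)"
proof -
  let ?f = "\<lambda>v. charge E d n v ^^ n"
  have ge: "c u \<le> fold ?f vs c u" for vs c u
  proof (induction vs arbitrary: c)
    case (Cons w vs)
    from order_trans[OF charge_pow_ge Cons.IH] show ?case by simp
  qed simp
  have step: "settled E d n v (?f v c)" for c
    using settled_charge_pow[of E d n v n c] by (auto simp: settled_def alive_def)
  have "[0..<n] = [0..<v] @ v # [Suc v..<n]"
    using assms by (rule upt_split)
  then have "charge_all E d n c = fold ?f [Suc v..<n] (?f v (fold ?f [0..<v] c))"
    unfolding charge_all_def by (simp only: fold_append fold_simps o_apply)
  then show ?thesis using settled_mono[OF ge[of "?f v (fold ?f [0..<v] c)" _ "[Suc v..<n]"] step] by simp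
qed

section \<open>Greedy multicovering\<close>

definition pick :: "nat rel \<Rightarrow> nat \<Rightarrow> nat \<Rightarrow> nat \<Rightarrow> nat \<Rightarrow> (nat \<Rightarrow> nat) \<Rightarrow> nat \<Rightarrow> nat" where
  "pick E d n \<tau> u c =
     (if u \<in> alive n c \<and> \<tau> \<le> cov E d (alive n c) u then c(u := n) else c)"

definition pick_pass :: "nat rel \<Rightarrow> nat \<Rightarrow> nat \<Rightarrow> nat \<Rightarrow> (nat \<Rightarrow> nat) \<Rightarrow> nat \<Rightarrow> nat" where
  "pick_pass E d n \<tau> = fold (pick E d n \<tau>) [0..<n]"

definition greedy :: "nat rel \<Rightarrow> nat \<Rightarrow> nat \<Rightarrow> (nat \<Rightarrow> nat) \<Rightarrow> nat \<Rightarrow> nat" where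
  "greedy E d n = fold (\<lambda>a. pick_pass E d n (2 * n - a)) [0..<2 * n]"

lemma alive_update: "alive n (c(u := n)) = alive n c - {u}"
  by (auto simp: alive_def)

lemma alive_pick: "alive n (pick E d n \<tau> u c) \<subseteq> alive n c"
  by (auto simp: pick_def alive_update)

lemma alive_fold_pick: "alive n (fold (pick E d n \<tau>) us c) \<subseteq> alive n c"
proof (induction us arbitrary: c)
  case (Cons u us)
  from order_trans[OF Cons.IH alive_pick] show ?case by simp
qed simp

text \<open>When its turn came, \<open>u\<close> was not removed, so its coverage was below the
  threshold then; by \<open>cov_mono\<close> the removals after that only lower it.\<close>

lemma pick_pass_cov:
  assumes "u \<in> alive n (pick_pass E d n \<tau> c)"
  shows "cov E d (alive n (pick_pass E d n \<tau> c)) u < \<tau>"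
proof -
  have "u < n" using assms by (simp add: alive_def)
  then have "[0..<n] = [0..<u] @ u # [Suc u..<n]"
    by (rule upt_split)
  then obtain c' where c': "pick_pass E d n \<tau> c = fold (pick E d n \<tau>) [Suc u..<n] (pick E d n \<tau> u c')"
    unfolding pick_pass_def by simp
  let ?S = "alive n (pick E d n \<tau> u c')"
  have sub: "alive n (pick_pass E d n \<tau> c) \<subseteq> ?S" unfolding c' by (rule alive_fold_pick)
  with assms have "u \<in> ?S" by blast
  then have "cov E d ?S u < \<tau>" by (auto simp: pick_def alive_update split: if_splits)
  with cov_mono[OF finite_alive sub, of E d u] show ?thesis by simp
qed

text \<open>
  As \<open>\<tau>\<close> decreases by one, the second summand of the potential \<open>|F| + excess / \<tau>\<close> grows by at most
  \<open>opt / \<tau>\<close>, while removing a vertex of coverage at least \<open>\<tau>\<close> does not increase the potential.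
\<close>

definition potential :: "nat rel \<Rightarrow> nat \<Rightarrow> nat \<Rightarrow> nat \<Rightarrow> (nat \<Rightarrow> nat) \<Rightarrow> real" where
  "potential E d n \<tau> c = real (card ({..<n} - alive n c)) + real (excess E d (alive n c)) / real \<tau>"

text \<open>One more deletion is paid for by a drop of at least \<open>\<tau>\<close> in the excess,
  that is, of at least 1 in the quotient.\<close>

lemma potential_pick:
  assumes "sym E" "irrefl E" "\<tau> > 0"
  shows "potential E d n \<tau> (pick E d n \<tau> u c) \<le> potential E d n \<tau> c"
proof (cases "u \<in> alive n c \<and> \<tau> \<le> cov E d (alive n c) u")
  case True
  let ?S = "alive n c"
  have "excess E d (?S - {u}) + \<tau> \<le> excess E d ?S"
    using excess_remove[OF finite_alive assms(1,2), of u n c d] True by simp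
  then have "real (excess E d (?S - {u})) + real \<tau> \<le> real (excess E d ?S)" by linarith
  then have "real (excess E d (?S - {u})) / real \<tau> + 1 \<le> real (excess E d ?S) / real \<tau>"
    using assms(3) by (simp add: pos_le_divide_eq distrib_right)
  moreover have "card ({..<n} - (?S - {u})) \<le> card ({..<n} - ?S) + 1"
  proof -
    have "{..<n} - (?S - {u}) \<subseteq> insert u ({..<n} - ?S)" by auto
    from card_mono[OF _ this] show ?thesis by (simp add: card_insert_if split: if_splits)
  qed
  moreover have "pick E d n \<tau> u c = c(u := n)" using True by (auto simp: pick_def)
  ultimately show ?thesis unfolding potential_def by (simp add: alive_update)
next
  case False
  then have "pick E d n \<tau> u c = c" by (auto simp: pick_def)
  then show ?thesis by simp
qed

lemma potential_pick_pass:
  assumes "sym E" "irrefl E" "\<tau> > 0"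
  shows "potential E d n \<tau> (pick_pass E d n \<tau> c) \<le> potential E d n \<tau> c"
proof -
  have "potential E d n \<tau> (fold (pick E d n \<tau>) us c) \<le> potential E d n \<tau> c" for us
  proof (induction us arbitrary: c)
    case (Cons u us)
    from order_trans[OF Cons.IH potential_pick[OF assms]] show ?case by simp
  qed simp
  then show ?thesis by (simp add: pick_pass_def)
qed

text \<open>The lower bound that greedy is compared with: the members of \<open>X\<close> together
  cover the whole excess, and each live one covers at most \<open>\<tau>\<close>.\<close>

lemma excess_le_card:
  assumes "sym E" "X \<subseteq> {..<n}" "bounded_deg E d ({..<n} - X)"
    and "\<And>u. u \<in> alive n c \<Longrightarrow> cov E d (alive n c) u \<le> \<tau>"
  shows "excess E d (alive n c) \<le> \<tau> * card X"
proof -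
  let ?S = "alive n c"
  have "bounded_deg E d (?S - X)"
    by (rule bounded_deg_subset[OF _ _ assms(3)]) (use alive_subset in auto)
  then have "excess E d ?S \<le> (\<Sum>u\<in>?S \<inter> X. cov E d ?S u)"
    by (rule excess_le_sum_cov[OF finite_alive assms(1)])
  also have "\<dots> \<le> (\<Sum>u\<in>?S \<inter> X. \<tau>)" by (intro sum_mono assms(4)) auto
  also have "\<dots> \<le> \<tau> * card X"
    using card_mono[of X "?S \<inter> X"] finite_subset[OF assms(2)] by simp
  finally show ?thesis .
qed

lemma pick_pass_id:
  assumes "\<And>u. u \<in> alive n c \<Longrightarrow> cov E d (alive n c) u < \<tau>"
  shows "pick_pass E d n \<tau> c = c"
proof -
  have id: "pick E d n \<tau> u c = c" for u using assms[of u] by (auto simp: pick_def)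
  have "fold (pick E d n \<tau>) us c = c" for us
    by (induction us) (auto simp: id)
  then show ?thesis by (simp add: pick_pass_def)
qed

text \<open>Passes with \<open>\<tau> > T\<close> remove nothing, so the harmonic sum stops at \<open>T\<close>.\<close>

lemma potential_pass_step:
  assumes "sym E" "irrefl E" "X \<subseteq> {..<n}" "bounded_deg E d ({..<n} - X)"
    and \<tau>: "\<And>u. u \<in> alive n c \<Longrightarrow> cov E d (alive n c) u \<le> \<tau>"
    and T: "\<And>u. u \<in> alive n c \<Longrightarrow> cov E d (alive n c) u \<le> T"
    and pot: "potential E d n \<tau> c \<le> b + real (card X) * (1 + (\<Sum>s\<in>{\<tau><..T}. 1 / real s))"
    and dead: "\<tau> \<ge> T \<Longrightarrow> real (card ({..<n} - alive n c)) \<le> b"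
    and \<tau>1: "\<tau> > 1"
  defines "c' \<equiv> pick_pass E d n \<tau> c"
  shows "potential E d n (\<tau> - 1) c' \<le> b + real (card X) * (1 + (\<Sum>s\<in>{\<tau> - 1<..T}. 1 / real s))"
    and "\<tau> - 1 \<ge> T \<Longrightarrow> real (card ({..<n} - alive n c')) \<le> b"
proof -
  have "cov E d (alive n c') u \<le> \<tau> - 1" if "u \<in> alive n c'" for u
    using pick_pass_cov[of u n E d \<tau> c] that unfolding c'_def by linarith
  then have ex: "excess E d (alive n c') \<le> (\<tau> - 1) * card X"
    by (rule excess_le_card[OF assms(1,3,4)])
  show dead': "real (card ({..<n} - alive n c')) \<le> b" if "\<tau> - 1 \<ge> T"
  proof -
    have "cov E d (alive n c) u < \<tau>" if "u \<in> alive n c" for u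
      using T[OF that] \<open>\<tau> - 1 \<ge> T\<close> \<tau>1 by linarith
    then have "c' = c" unfolding c'_def by (rule pick_pass_id)
    with dead that show ?thesis by simp
  qed
  have ex': "real (excess E d (alive n c')) / real (\<tau> - 1) \<le> real (card X)"
  proof -
    have "real (excess E d (alive n c')) \<le> real (card X) * real (\<tau> - 1)"
      using ex by (metis mult.commute of_nat_le_iff of_nat_mult)
    then show ?thesis using \<tau>1 by (subst divide_le_eq) simp
  qed
  show "potential E d n (\<tau> - 1) c' \<le> b + real (card X) * (1 + (\<Sum>s\<in>{\<tau> - 1<..T}. 1 / real s))"
  proof (cases "\<tau> - 1 \<ge> T")
    case True
    \<comment> \<open>Here the harmonic sum is still empty: nothing has been removed yet, and the
      excess term alone is at most \<open>card X\<close>.\<close>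
    with dead' ex' show ?thesis by (simp add: potential_def)
  next
    case False
    then have "{\<tau> - 1<..T} = insert \<tau> {\<tau><..T}" using \<tau>1 by auto
    then have "(\<Sum>s\<in>{\<tau> - 1<..T}. 1 / real s) = 1 / real \<tau> + (\<Sum>s\<in>{\<tau><..T}. 1 / real s)" by simp
    moreover have "potential E d n (\<tau> - 1) c' \<le> potential E d n \<tau> c' + real (card X) / real \<tau>"
    proof -
      let ?e = "real (excess E d (alive n c'))"
      \<comment> \<open>Since
        \<open>1 / (\<tau> - 1) - 1 / \<tau> = 1 / (\<tau> * (\<tau> - 1))\<close>, the growth is
        the new quotient divided by \<open>\<tau>\<close>, and \<open>ex'\<close> bounds that
        quotient.\<close>
      have "?e / real (\<tau> - 1) = ?e / real \<tau> + (?e / real (\<tau> - 1)) / real \<tau>"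
        using \<tau>1 by (simp add: field_simps)
      also have "\<dots> \<le> ?e / real \<tau> + real (card X) / real \<tau>"
        using ex' by (intro add_left_mono divide_right_mono) auto
      finally show ?thesis by (simp add: potential_def)
    qed
    moreover have "potential E d n \<tau> c' \<le> potential E d n \<tau> c"
      unfolding c'_def using \<tau>1 by (intro potential_pick_pass assms(1,2)) simp
    ultimately show ?thesis using pot by (simp add: algebra_simps)
  qed
qed

lemma alive_pick_pass: "alive n (pick_pass E d n \<tau> c) \<subseteq> alive n c"
  unfolding pick_pass_def by (rule alive_fold_pick)

text \<open>The starting potential exceeds the initial number of dead vertices by at most
  \<open>card X\<close>, and each lowering of a threshold \<open>\<tau> \<le> T\<close> adds at most
  \<open>card X / \<tau>\<close>. Feasibility holds because after the pass with threshold 1 every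
  coverage is 0.\<close>

lemma greedy_bound:
  assumes "sym E" "irrefl E" "X \<subseteq> {..<n}" "bounded_deg E d ({..<n} - X)"
    and T: "\<And>u. u \<in> alive n c \<Longrightarrow> cov E d (alive n c) u \<le> T"
    and "n > 0"
  defines "c' \<equiv> greedy E d n c"
  shows "bounded_deg E d (alive n c')"
    and "real (card ({..<n} - alive n c'))
      \<le> real (card ({..<n} - alive n c)) + real (card X) * (1 + (\<Sum>s\<in>{1..T}. 1 / real s))"
proof -
  define b where "b = real (card ({..<n} - alive n c))"
  \<comment> \<open>\<open>g j\<close> is the state after \<open>j\<close> passes; the next pass has
    threshold \<open>2 * n - j\<close>.\<close>
  define g where "g j = fold (\<lambda>a. pick_pass E d n (2 * n - a)) [0..<j] c" for j
  have g_Suc: "g (Suc j) = pick_pass E d n (2 * n - j) (g j)" for j by (simp add: g_def)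
  have sub: "alive n (g j) \<subseteq> alive n c" for j
  proof (induction j)
    case (Suc j)
    from order_trans[OF alive_pick_pass Suc.IH] show ?case by (simp add: g_Suc)
  qed (simp add: g_def)
  have gT: "cov E d (alive n (g j)) u \<le> T" if "u \<in> alive n (g j)" for u j
    using cov_mono[OF finite_alive sub[of j], of E d u] T[of u] sub[of j] that by fastforce
  have cov_n: "cov E d (alive n (g 0)) u \<le> 2 * n" if "u \<in> alive n (g 0)" for u
  proof -
    have "deg E (alive n (g 0)) u \<le> n" using deg_alive[OF assms(2) that] .
    moreover from this have "card {v \<in> nbrs E (alive n (g 0)) u. d < deg E (alive n (g 0)) v} \<le> n"
      unfolding deg_def by (rule order_trans[OF card_mono, rotated 2]) (auto intro: finite_nbrs finite_alive)
    ultimately show ?thesis unfolding cov_def by linarith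
  qed
  \<comment> \<open>For \<open>j = 0\<close> this is the trivial bound on coverage, afterwards the
    effect of the preceding pass. At \<open>j = 2 * n\<close> it yields coverage 0.\<close>
  have cov_g: "cov E d (alive n (g j)) u \<le> 2 * n - j" if "u \<in> alive n (g j)" for j u
  proof (cases j)
    case 0
    then show ?thesis using cov_n that by simp
  next
    case (Suc i)
    then show ?thesis using pick_pass_cov[of u n E d "2 * n - i" "g i"] that by (simp add: g_Suc)
  qed
  have main: "potential E d n (2 * n - j) (g j) \<le> b + real (card X) * (1 + (\<Sum>s\<in>{2 * n - j<..T}. 1 / real s))
      \<and> (2 * n - j \<ge> T \<longrightarrow> real (card ({..<n} - alive n (g j))) \<le> b)" if "j < 2 * n" for j
    using that
  proof (induction j)
    case 0
    have "excess E d (alive n (g 0)) \<le> 2 * n * card X"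
      by (rule excess_le_card[OF assms(1,3,4) cov_n])
    then have "real (excess E d (alive n (g 0))) / real (2 * n) \<le> real (card X)"
    proof -
      have "real (excess E d (alive n (g 0))) \<le> real (card X) * real (2 * n)"
        using \<open>excess E d (alive n (g 0)) \<le> 2 * n * card X\<close> by (metis mult.commute of_nat_le_iff of_nat_mult)
      then show ?thesis using \<open>n > 0\<close> by (subst divide_le_eq) simp
    qed
    moreover have "0 \<le> real (card X) * (\<Sum>s\<in>{2 * n<..T}. 1 / real s)"
      by (intro mult_nonneg_nonneg sum_nonneg) auto
    ultimately show ?case by (simp add: potential_def b_def g_def algebra_simps)
  next
    case (Suc j)
    then have "2 * n - j > 1" "j < 2 * n" by auto
    then have IH: "potential E d n (2 * n - j) (g j)
        \<le> b + real (card X) * (1 + (\<Sum>s\<in>{2 * n - j<..T}. 1 / real s))"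
      "2 * n - j \<ge> T \<Longrightarrow> real (card ({..<n} - alive n (g j))) \<le> b"
      using Suc.IH by auto
    note step = potential_pass_step[OF assms(1-4) cov_g[of _ j] gT[of _ j] IH \<open>2 * n - j > 1\<close>]
    have "2 * n - Suc j = 2 * n - j - 1" by simp
    with step show ?case unfolding g_Suc by metis
  qed
  have c'_eq: "c' = g (2 * n)" by (simp add: c'_def greedy_def g_def)
  define j where "j = 2 * n - 1"
  have j: "2 * n = Suc j" "2 * n - j = 1" "j < 2 * n" using \<open>n > 0\<close> by (auto simp: j_def)
  show "bounded_deg E d (alive n c')"
    using cov_g[where j = "2 * n"] by (intro bounded_deg_if_cov_0) (auto simp: c'_eq)
  \<comment> \<open>The final pass stands outside the induction: lowering the threshold 1 once more
    would put 0 in the denominator.\<close>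
  have "c' = pick_pass E d n 1 (g j)" unfolding c'_eq j(1) g_Suc using j by simp
  then have "potential E d n 1 c' \<le> potential E d n 1 (g j)"
    using potential_pick_pass[OF assms(1,2)] by simp
  also have "\<dots> \<le> b + real (card X) * (1 + (\<Sum>s\<in>{1<..T}. 1 / real s))"
    using main[OF j(3)] j(2) by simp
  also have "\<dots> \<le> b + real (card X) * (1 + (\<Sum>s\<in>{1..T}. 1 / real s))"
    by (intro add_left_mono mult_left_mono sum_mono2) auto
  finally show "real (card ({..<n} - alive n c')) \<le> b + real (card X) * (1 + (\<Sum>s\<in>{1..T}. 1 / real s))"
    by (simp add: potential_def)
qed

section \<open>Composition of the two phases\<close>

definition final_charges :: "nat rel \<Rightarrow> nat \<Rightarrow> nat \<Rightarrow> nat \<Rightarrow> nat" where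
  "final_charges E d n = greedy E d n (charge_all E d n (\<lambda>_. 0))"

text \<open>Charging accounts for 8, the starting potential of greedy for 1, and the falling
  threshold for the harmonic sum.\<close>

definition ratio :: "nat \<Rightarrow> real" where
  "ratio d = 9 + (\<Sum>s\<in>{1..3 * d}. 1 / real s)"

text \<open>Any feasible \<open>X\<close> serves as the yardstick for both phases, since it stays
  feasible for the graph left by charging.\<close>

lemma final_charges_correct:
  assumes "sym E" "irrefl E" "X \<subseteq> {..<n}" "bounded_deg E d ({..<n} - X)"
  shows "bounded_deg E d (alive n (final_charges E d n))"
    and "real (card ({..<n} - alive n (final_charges E d n))) \<le> ratio d * real (card X)"
proof -
  let ?c = "charge_all E d n (\<lambda>_. 0)"
  have inv: "charge_inv n X ?c"
    by (rule charge_inv_charge_all[OF assms]) (simp add: charge_inv_def)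
  have deg2: "deg E (alive n ?c) u \<le> 2 * d" if "u \<in> alive n ?c" for u
    using settled_charge_all[of u n E d "\<lambda>_. 0"] that by (auto simp: settled_def alive_def)
  \<comment> \<open>The own excess is at most \<open>2 * d - d\<close>, and there are at most
    \<open>2 * d\<close> neighbours.\<close>
  have cov3: "cov E d (alive n ?c) u \<le> 3 * d" if "u \<in> alive n ?c" for u
  proof -
    have "card {v \<in> nbrs E (alive n ?c) u. d < deg E (alive n ?c) v} \<le> deg E (alive n ?c) u"
      unfolding deg_def[of _ _ u] by (intro card_mono) (auto intro: finite_nbrs finite_alive)
    with deg2[OF that] show ?thesis unfolding cov_def by linarith
  qed
  have dead: "real (card ({..<n} - alive n ?c)) \<le> 8 * real (card X)"
    using card_dead_le[OF assms(3) inv] by linarith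
  show "bounded_deg E d (alive n (final_charges E d n))"
    using greedy_bound(1)[OF assms cov3]
    by (cases "n = 0") (auto simp: final_charges_def alive_def bounded_deg_def)
  show "real (card ({..<n} - alive n (final_charges E d n))) \<le> ratio d * real (card X)"
  proof (cases "n = 0")
    case False
    then show ?thesis
      using greedy_bound(2)[OF assms cov3] dead by (simp add: final_charges_def ratio_def algebra_simps)
  next
    case True
    then show ?thesis using assms(3) by simp
  qed
qed

section \<open>Verification of random access machine programs\<close>

text \<open>Here \<open>m\<close> bounds the number of iterations of each single execution of a loop.\<close>

fun cost :: "nat \<Rightarrow> com \<Rightarrow> nat" where
  "cost m (Seq c1 c2) = cost m c1 + cost m c2"
| "cost m (Cond a c1 c2) = 1 + cost m c1 + cost m c2"
| "cost m (While a c) = 1 + m * (1 + cost m c)"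
| "cost m _ = 1"

text \<open>The program is fixed, so only the iteration bound varies: a loop multiplies by
  \<open>m\<close>, which is the polynomial \<open>[:0, 1:]\<close>, and the degree is limited by
  the nesting depth.\<close>

lemma cost_poly: "\<exists>p. \<forall>m. cost m c = poly p m"
proof (induction c)
  case (Seq c1 c2)
  then obtain p1 p2 where "\<forall>m. cost m c1 = poly p1 m" "\<forall>m. cost m c2 = poly p2 m" by blast
  then have "\<forall>m. cost m (Seq c1 c2) = poly (p1 + p2) m" by simp
  then show ?case by blast
next
  case (Cond a c1 c2)
  then obtain p1 p2 where "\<forall>m. cost m c1 = poly p1 m" "\<forall>m. cost m c2 = poly p2 m" by blast
  then have "\<forall>m. cost m (Cond a c1 c2) = poly (1 + p1 + p2) m" by simp
  then show ?case by blast
next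
  case (While a c)
  then obtain p where "\<forall>m. cost m c = poly p m" by blast
  then have "\<forall>m. cost m (While a c) = poly (1 + [:0, 1:] * (1 + p)) m" by simp
  then show ?case by blast
qed (intro exI[of _ 1]; simp)+

text \<open>Total correctness with at most \<open>m\<close> iterations per loop execution. The loop
  clause asks for an explicit trace \<open>f\<close> of the states at the loop test, so the
  recursion stays on the program text.\<close>

primrec wp :: "nat list \<Rightarrow> nat \<Rightarrow> com \<Rightarrow> (state \<Rightarrow> bool) \<Rightarrow> state \<Rightarrow> bool" where
  "wp xs m Skip Q s = Q s"
| "wp xs m (Const r k) Q s = Q ((fst s)(r := k), snd s)"
| "wp xs m (Add r a b) Q s = Q ((fst s)(r := fst s a + fst s b), snd s)"
| "wp xs m (Sub r a b) Q s = Q ((fst s)(r := fst s a - fst s b), snd s)"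
| "wp xs m (Load r a) Q s = Q ((fst s)(r := fst s (fst s a)), snd s)"
| "wp xs m (Store r a) Q s = Q ((fst s)(fst s r := fst s a), snd s)"
| "wp xs m (Read r a) Q s =
     Q ((fst s)(r := (if fst s a < length xs then xs ! fst s a else 0)), snd s)"
| "wp xs m (Write a) Q s = Q (fst s, snd s @ [fst s a])"
| "wp xs m (Seq c1 c2) Q s = wp xs m c1 (wp xs m c2 Q) s"
| "wp xs m (Cond a c1 c2) Q s = (if fst s a \<noteq> 0 then wp xs m c1 Q s else wp xs m c2 Q s)"
| "wp xs m (While a c) Q s =
     (\<exists>N f. N \<le> m \<and> f 0 = s \<and>
        (\<forall>i<N. fst (f i) a \<noteq> 0 \<and> wp xs m c (\<lambda>s'. s' = f (Suc i)) (f i)) \<and>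
        fst (f N) a = 0 \<and> Q (f N))"

lemma wp_mono: "wp xs m c Q s \<Longrightarrow> (\<And>s. Q s \<Longrightarrow> Q' s) \<Longrightarrow> wp xs m c Q' s"
proof (induction c arbitrary: Q Q' s)
  case (Seq c1 c2)
  have "wp xs m c1 (wp xs m c2 Q) s" using Seq.prems(1) by simp
  then have "wp xs m c1 (wp xs m c2 Q') s"
    by (rule Seq.IH(1)) (rule Seq.IH(2)[OF _ Seq.prems(2)])
  then show ?case by simp
next
  case (Cond a c1 c2)
  show ?case
    using Cond.prems(1) Cond.IH(1)[OF _ Cond.prems(2)] Cond.IH(2)[OF _ Cond.prems(2)]
    by (simp split: if_splits)
next
  case (While a c)
  from While.prems(1) obtain N f where "N \<le> m" "f 0 = s"
    "\<forall>i<N. fst (f i) a \<noteq> 0 \<and> wp xs m c (\<lambda>s'. s' = f (Suc i)) (f i)" "fst (f N) a = 0" "Q (f N)"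
    by auto
  with While.prems(2) have "N \<le> m \<and> f 0 = s \<and>
      (\<forall>i<N. fst (f i) a \<noteq> 0 \<and> wp xs m c (\<lambda>s'. s' = f (Suc i)) (f i)) \<and> fst (f N) a = 0 \<and> Q' (f N)"
    by blast
  then show ?case unfolding wp.simps by blast
qed simp_all

text \<open>Turns a postcondition into one concrete final state, as needed for the next entry of a
  loop trace.\<close>

lemma wp_ex: "wp xs m c Q s \<Longrightarrow> \<exists>s'. Q s' \<and> wp xs m c (\<lambda>x. x = s') s"
proof (induction c arbitrary: Q s)
  case (Seq c1 c2)
  from Seq.IH(1)[of "wp xs m c2 Q" s] Seq.prems
  obtain s1 where s1: "wp xs m c2 Q s1" "wp xs m c1 (\<lambda>x. x = s1) s" by auto
  then obtain s2 where s2: "Q s2" "wp xs m c2 (\<lambda>x. x = s2) s1" using Seq.IH(2) by blast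
  have "wp xs m (Seq c1 c2) (\<lambda>x. x = s2) s"
    using wp_mono[OF s1(2), of "wp xs m c2 (\<lambda>x. x = s2)"] s2(2) by simp
  with s2(1) show ?case by blast
next
  case (While a c)
  then obtain N f where "N \<le> m" "f 0 = s"
    "\<forall>i<N. fst (f i) a \<noteq> 0 \<and> wp xs m c (\<lambda>s'. s' = f (Suc i)) (f i)" "fst (f N) a = 0" "Q (f N)"
    by auto
  then have "Q (f N) \<and> wp xs m (While a c) (\<lambda>x. x = f N) s" unfolding wp.simps by blast
  then show ?case by blast
qed (auto split: if_splits)

lemma wp_sound: "wp xs m c Q s \<Longrightarrow> \<exists>t s'. exec xs c s t s' \<and> t \<le> cost m c \<and> Q s'"
proof (induction c arbitrary: Q s)
  case (Seq c1 c2)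
  from Seq.IH(1)[of "wp xs m c2 Q" s] Seq.prems
  obtain t1 s1 where 1: "exec xs c1 s t1 s1" "t1 \<le> cost m c1" "wp xs m c2 Q s1" by auto
  then obtain t2 s2 where "exec xs c2 s1 t2 s2" "t2 \<le> cost m c2" "Q s2" using Seq.IH(2) by blast
  with 1 have "exec xs (Seq c1 c2) s (t1 + t2) s2 \<and> t1 + t2 \<le> cost m (Seq c1 c2) \<and> Q s2"
    by (auto intro: exec.Seq)
  then show ?case by blast
next
  case (Cond a c1 c2)
  show ?case
  proof (cases "fst s a = 0")
    case True
    with Cond.IH(2)[of Q s] Cond.prems obtain t s' where "exec xs c2 s t s'" "t \<le> cost m c2" "Q s'" by auto
    with True have "exec xs (Cond a c1 c2) s (1 + t) s' \<and> 1 + t \<le> cost m (Cond a c1 c2) \<and> Q s'"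
      by (auto intro: exec.CondFalse simp del: One_nat_def)
    then show ?thesis by blast
  next
    case False
    with Cond.IH(1)[of Q s] Cond.prems obtain t s' where "exec xs c1 s t s'" "t \<le> cost m c1" "Q s'" by auto
    with False have "exec xs (Cond a c1 c2) s (1 + t) s' \<and> 1 + t \<le> cost m (Cond a c1 c2) \<and> Q s'"
      by (auto intro: exec.CondTrue simp del: One_nat_def)
    then show ?thesis by blast
  qed
next
  case (While a c)
  then obtain N f where f: "N \<le> m" "f 0 = s"
    "\<And>i. i < N \<Longrightarrow> fst (f i) a \<noteq> 0 \<and> wp xs m c (\<lambda>s'. s' = f (Suc i)) (f i)"
    "fst (f N) a = 0" "Q (f N)"
    by auto
  \<comment> \<open>Induction on the number \<open>k\<close> of iterations still to run, starting
    from the end of the trace.\<close>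
  have "k \<le> N \<Longrightarrow> \<exists>t. exec xs (While a c) (f (N - k)) t (f N) \<and> t \<le> 1 + k * (1 + cost m c)" for k
  proof (induction k)
    case 0
    then show ?case using exec.WhileFalse[of "f N" a xs c] f(4) by auto
  next
    case (Suc k)
    then obtain t2 where t2: "exec xs (While a c) (f (N - k)) t2 (f N)" "t2 \<le> 1 + k * (1 + cost m c)"
      by auto
    define i where "i = N - Suc k"
    have i: "i < N" "N - k = Suc i" using Suc.prems by (auto simp: i_def)
    obtain t1 where t1: "exec xs c (f i) t1 (f (Suc i))" "t1 \<le> cost m c"
      using While.IH[of "\<lambda>s'. s' = f (Suc i)" "f i"] f(3)[OF i(1)] by blast
    have "exec xs (While a c) (f i) (1 + t1 + t2) (f N)"
      using exec.WhileTrue[of "f i" a xs c t1 "f (Suc i)" t2 "f N"] f(3)[OF i(1)] t1 t2 i by simp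
    moreover have "1 + t1 + t2 \<le> 1 + Suc k * (1 + cost m c)" using t1 t2 by simp
    ultimately show ?case unfolding i_def by blast
  qed
  from this[of N] obtain t where t: "exec xs (While a c) s t (f N)" "t \<le> 1 + N * (1 + cost m c)"
    using f(2) by auto
  have "N * (1 + cost m c) \<le> m * (1 + cost m c)" using f(1) by (rule mult_le_mono1)
  with t have "t \<le> cost m (While a c)" by simp
  with t(1) f(5) show ?case by blast
qed (cases s; force intro: exec.intros simp del: One_nat_def)+

text \<open>The invariant carries the iteration number, so the known count \<open>N\<close> also
  gives termination. The trace arises by repeatedly choosing a successor state that satisfies the
  invariant.\<close>

lemma wp_While:
  assumes "N \<le> m" "I 0 s"
    and step: "\<And>i s. i < N \<Longrightarrow> I i s \<Longrightarrow> fst s a \<noteq> 0 \<and> wp xs m c (I (Suc i)) s"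
    and final: "\<And>s. I N s \<Longrightarrow> fst s a = 0 \<and> Q s"
  shows "wp xs m (While a c) Q s"
proof -
  define g where "g i s = (SOME s'. I (Suc i) s' \<and> wp xs m c (\<lambda>x. x = s') s)" for i s
  have g: "I (Suc i) (g i s) \<and> wp xs m c (\<lambda>x. x = g i s) s" if "i < N" "I i s" for i s
    unfolding g_def by (rule someI_ex) (use step[OF that] wp_ex in blast)
  define f where "f = rec_nat s g"
  have f: "f 0 = s" "f (Suc i) = g i (f i)" for i by (auto simp: f_def)
  have I: "i \<le> N \<Longrightarrow> I i (f i)" for i
    by (induction i) (auto simp: f assms(2) g)
  have "N \<le> m \<and> f 0 = s \<and> (\<forall>i<N. fst (f i) a \<noteq> 0 \<and> wp xs m c (\<lambda>s'. s' = f (Suc i)) (f i)) \<and>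
      fst (f N) a = 0 \<and> Q (f N)"
    using I g step final assms(1) by (auto simp: f)
  then show ?thesis unfolding wp.simps by blast
qed

text \<open>Register 1 has to hold the number 1.\<close>

definition For :: "nat \<Rightarrow> nat \<Rightarrow> nat \<Rightarrow> com \<Rightarrow> com" where
  "For i t bnd body =
     Seq (Const i 0) (Seq (Sub t bnd i) (While t (Seq body (Seq (Add i i 1) (Sub t bnd i)))))"

text \<open>Invariants may restrict all registers, so they are required of the memory after the
  counter \<open>i\<close> and the test register \<open>t\<close> are updated. Register
  \<open>t\<close> holds the number of remaining iterations, which makes \<open>j < N\<close> a
  nonzero test.\<close>

lemma wp_For:
  assumes "M bnd = N" "N \<le> m" "i \<noteq> t" "bnd \<noteq> i" "bnd \<noteq> t" "i \<noteq> 1" "t \<noteq> 1"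
    and init: "I 0 (M(i := 0, t := N)) out"
    and step: "\<And>j M out. j < N \<Longrightarrow> I j M out \<Longrightarrow> M i = j \<Longrightarrow> M bnd = N \<Longrightarrow>
      wp xs m body (\<lambda>(M', out'). M' i = j \<and> M' bnd = N \<and> M' 1 = 1 \<and>
        I (Suc j) (M'(i := Suc j, t := N - Suc j)) out') (M, out)"
    and final: "\<And>M out. I N M out \<Longrightarrow> Q (M, out)"
  shows "wp xs m (For i t bnd body) Q (M, out)"
proof -
  let ?J = "\<lambda>j (M, out). I j M out \<and> M i = j \<and> M t = N - j \<and> M bnd = N"
  have "wp xs m (While t (Seq body (Seq (Add i i 1) (Sub t bnd i)))) Q (M(i := 0, t := N), out)"
  proof (rule wp_While[of N m ?J])
    fix j s assume j: "j < N" "?J j s"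
    obtain M out where s: "s = (M, out)" by fastforce
    from wp_mono[OF step[of j M out]] j assms
    show "fst s t \<noteq> 0 \<and> wp xs m (Seq body (Seq (Add i i 1) (Sub t bnd i))) (?J (Suc j)) s"
      by (auto simp: s elim!: wp_mono[rotated])
  qed (use assms in auto)
  then show ?thesis using assms by (simp add: For_def)
qed

section \<open>The program\<close>

text \<open>
  Registers 1 to 6 hold the constants \<open>1\<close>, \<open>n\<close>, \<open>d\<close>, \<open>2 d\<close>, \<open>2 n\<close> and \<open>30\<close>, the registers 7 to 21 are
  working registers, and the charge of vertex \<open>u\<close> is kept in register \<open>30 + u\<close>.
\<close>

definition charges :: "(nat \<Rightarrow> nat) \<Rightarrow> nat \<Rightarrow> nat" where
  "charges M u = M (30 + u)"

definition same :: "nat set \<Rightarrow> (nat \<Rightarrow> nat) \<Rightarrow> (nat \<Rightarrow> nat) \<Rightarrow> bool" where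
  "same R M M' \<longleftrightarrow> (\<forall>r. r \<notin> R \<longrightarrow> M' r = M r)"

text \<open>Like \<^const>\<open>same\<close>, but the charges may change.\<close>

definition same_regs :: "nat set \<Rightarrow> (nat \<Rightarrow> nat) \<Rightarrow> (nat \<Rightarrow> nat) \<Rightarrow> bool" where
  "same_regs R M M' \<longleftrightarrow> (\<forall>r<30. r \<notin> R \<longrightarrow> M' r = M r)"

text \<open>
  Register \<open>b\<close> passes the live neighbours of the vertex in register \<open>v\<close> to \<open>body\<close>.
  Without multiplication, the position \<open>2 + v n\<close> of the row of \<open>v\<close> has to be computed by a loop.
\<close>

definition nbr_loop :: "nat \<Rightarrow> nat \<Rightarrow> com \<Rightarrow> com" where
  "nbr_loop b v body =
     Seq (Const (b + 2) 2) (Seq (For b (b + 1) v (Add (b + 2) (b + 2) 2)) (For b (b + 1) 2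
       (Seq (Add (b + 3) (b + 2) b) (Seq (Read (b + 3) (b + 3)) (Cond (b + 3)
         (Seq (Add (b + 3) 6 b) (Seq (Load (b + 3) (b + 3)) (Seq (Sub (b + 3) 2 (b + 3))
           (Cond (b + 3) body Skip))))
         Skip)))))"

definition deg_prog :: "nat \<Rightarrow> nat \<Rightarrow> nat \<Rightarrow> com" where
  "deg_prog b v r = Seq (Const r 0) (nbr_loop b v (Add r r 1))"

text \<open>Register 13 starts at the charge of the vertex in register 7 and grows by one with each
  live neighbour, so that it ends at the new charge without the degree being kept.\<close>

definition charge_prog :: com where
  "charge_prog =
     Seq (Add 12 6 7) (Seq (Load 13 12) (Seq (Sub 12 2 13) (Cond 12
       (Seq (deg_prog 14 7 12) (Seq (Sub 12 12 4) (Cond 12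
         (Seq (nbr_loop 14 7
             (Seq (Add 12 6 14) (Seq (Load 11 12) (Seq (Add 11 11 1) (Seq (Store 12 11) (Add 13 13 1))))))
           (Seq (Add 12 6 7) (Store 12 13)))
         Skip)))
       Skip)))"

text \<open>Register 11 holds \<open>\<tau> - 1\<close>, so that \<open>\<tau> \<le> cov\<close> becomes a test for a nonzero difference.\<close>

definition pick_prog :: com where
  "pick_prog =
     Seq (Add 12 6 9) (Seq (Load 12 12) (Seq (Sub 12 2 12) (Cond 12
       (Seq (deg_prog 14 9 13) (Seq (Sub 13 13 3)
         (Seq (nbr_loop 14 9 (Seq (deg_prog 18 14 12) (Seq (Sub 12 12 3) (Cond 12 (Add 13 13 1) Skip))))
         (Seq (Sub 13 13 11) (Cond 13 (Seq (Add 12 6 9) (Store 12 2)) Skip)))))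
       Skip)))"

text \<open>Register 0 is still 0 and register 1 has just become 1, so they serve as the input
  addresses of \<open>n\<close> and \<open>k\<close>.\<close>

definition init_prog :: com where
  "init_prog =
     Seq (Const 1 1) (Seq (Read 2 0) (Seq (Read 3 1) (Seq (Const 4 2) (Seq (Sub 3 3 4)
       (Seq (Add 4 3 3) (Seq (Add 5 2 2) (Const 6 30)))))))"

definition star_prog :: com where
  "star_prog =
     Seq init_prog
       (Seq (For 7 8 2 (For 9 10 2 charge_prog))
       (Seq (For 7 8 5 (Seq (Sub 11 5 7) (Seq (Sub 11 11 1) (For 9 10 2 pick_prog))))
       (For 9 10 2 (Seq (Add 12 6 9) (Seq (Load 12 12) (Seq (Sub 12 2 12) (Cond 12 Skip (Write 9))))))))"

text \<open>The assumption \<open>adj\<close> copies the form of \<open>Read\<close> with its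
  default 0, so that it rewrites a read directly; the offset 2 skips \<open>n\<close> and
  \<open>k\<close>. The longest loop, over the thresholds, makes \<open>2 * n\<close>
  iterations.\<close>

locale ram =
  fixes xs :: "nat list" and n d m :: nat and E :: "nat rel"
  assumes adj: "\<And>u v. u < n \<Longrightarrow> v < n \<Longrightarrow>
      (if 2 + u * n + v < length xs then xs ! (2 + u * n + v) else 0) = (if (u, v) \<in> E then 1 else 0)"
    and m: "2 * n \<le> m"
    and irrefl: "irrefl E"
begin

definition env :: "(nat \<Rightarrow> nat) \<Rightarrow> bool" where
  "env M \<longleftrightarrow> M 1 = 1 \<and> M 2 = n \<and> M 3 = d \<and> M 4 = 2 * d \<and> M 5 = 2 * n \<and> M 6 = 30"

lemma wp_row:
  assumes "env M" "M v = V" "V < n" "7 \<le> b" "v \<notin> {b..b + 3}"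
    and Q: "\<And>M'. same {b..b + 3} M M' \<Longrightarrow> M' (b + 2) = 2 + V * n \<Longrightarrow> Q (M', out)"
  shows "wp xs m (Seq (Const (b + 2) 2) (For b (b + 1) v (Add (b + 2) (b + 2) 2))) Q (M, out)"
proof -
  let ?I = "\<lambda>j M' out'. out' = out \<and> same {b..b + 3} M M' \<and> M' (b + 2) = 2 + j * n"
  have "wp xs m (For b (b + 1) v (Add (b + 2) (b + 2) 2)) Q (M(b + 2 := 2), out)"
  proof (rule wp_For[where N = V and I = ?I], goal_cases)
    case (9 j M1 out1)
    then have "M1 1 = 1" "M1 2 = n" using assms by (auto simp: same_def env_def)
    with 9 assms show ?case by (auto simp: same_def)
  qed (use assms m in \<open>auto simp: same_def\<close>)
  then show ?thesis by simp
qed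

text \<open>Hides the address arithmetic behind an invariant over the vertices. By
  \<open>frame\<close> it ignores the bookkeeping registers, of which \<open>body\<close> must
  preserve the counter and the row address. Liveness is judged when \<open>j\<close> is visited, as
  \<open>body\<close> may alter charges.\<close>

lemma wp_nbr_loop:
  assumes M: "M v = V" "V < n" and regs: "7 \<le> b" "b + 3 < 30" "v \<notin> {b..b + 3}"
    and init: "I 0 M out"
    and env: "\<And>j M out. I j M out \<Longrightarrow> env M \<and> M v = V"
    and frame: "\<And>j M M' out. I j M out \<Longrightarrow> same {b..b + 3} M M' \<Longrightarrow> I j M' out"
    and body: "\<And>j M out. j < n \<Longrightarrow> I j M out \<Longrightarrow> (V, j) \<in> E \<Longrightarrow> charges M j < n \<Longrightarrow>
      M b = j \<Longrightarrow> M (b + 2) = 2 + V * n \<Longrightarrow>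
      wp xs m body (\<lambda>(M', out'). I (Suc j) M' out' \<and> M' b = j \<and> M' (b + 2) = 2 + V * n) (M, out)"
    and skip: "\<And>j M out. j < n \<Longrightarrow> I j M out \<Longrightarrow> \<not> ((V, j) \<in> E \<and> charges M j < n) \<Longrightarrow> I (Suc j) M out"
    and Q: "\<And>M out. I n M out \<Longrightarrow> Q (M, out)"
  shows "wp xs m (nbr_loop b v body) Q (M, out)"
proof -
  let ?inner = "Seq (Add (b + 3) 6 b) (Seq (Load (b + 3) (b + 3)) (Seq (Sub (b + 3) 2 (b + 3))
           (Cond (b + 3) body Skip)))"
  let ?body = "Seq (Add (b + 3) (b + 2) b) (Seq (Read (b + 3) (b + 3)) (Cond (b + 3) ?inner Skip))"
  let ?I = "\<lambda>j M out. I j M out \<and> M (b + 2) = 2 + V * n"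
  have loop: "wp xs m (For b (b + 1) 2 ?body) Q (M, out)" if "I 0 M out" "M (b + 2) = 2 + V * n" for M
  proof (rule wp_For[where N = n and I = ?I], goal_cases)
    case (9 j M1 out1)
    let ?post = "\<lambda>(M', out'). M' b = j \<and> M' 2 = n \<and> M' 1 = 1 \<and>
        I (Suc j) (M'(b := Suc j, b + 1 := n - Suc j)) out' \<and>
        (M'(b := Suc j, b + 1 := n - Suc j)) (b + 2) = 2 + V * n"
    have post: "?post (M', out')" if "I (Suc j) M' out'" "M' b = j" "M' (b + 2) = 2 + V * n" for M' out'
    proof -
      have "same {b..b + 3} M' (M'(b := Suc j, b + 1 := n - Suc j))" by (auto simp: same_def)
      from frame[OF that(1) this] env[OF that(1)] that show ?thesis by (simp add: env_def)
    qed
    have envM1: "M1 1 = 1" "M1 2 = n" "M1 6 = 30" using 9 env by (auto simp: env_def)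
    have I_upd: "I j (M1(b + 3 := x)) out1" for x
      by (rule frame[of j M1]) (use 9 in \<open>auto simp: same_def\<close>)
    have "n - charges M1 j > 0 \<longleftrightarrow> charges M1 j < n" by auto
    have entry: "(if 2 + V * n + j < length xs then xs ! (2 + V * n + j) else 0) = (if (V, j) \<in> E then 1 else 0)"
      using adj[of V j] M 9 by blast
    have step: "wp xs m ?body ?post (M1, out1)
        = wp xs m (Cond (b + 3) ?inner Skip) ?post (M1(b + 3 := if (V, j) \<in> E then 1 else 0), out1)"
    proof -
      have "M1 (b + 2) = 2 + V * n" "M1 b = j" using 9 by auto
      then show ?thesis
        unfolding entry[symmetric] by (simp only: wp.simps fst_conv snd_conv fun_upd_same fun_upd_upd)
    qed
    show ?case unfolding step
    proof (cases "(V, j) \<in> E")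
      case False
      have "?post (M1(b + 3 := 0), out1)"
        by (rule post) (use skip[OF _ I_upd] False 9 in auto)
      then show "wp xs m (Cond (b + 3) ?inner Skip) ?post (M1(b + 3 := if (V, j) \<in> E then 1 else 0), out1)"
        using False by simp
    next
      case True
      have ch: "charges (M1(b + 3 := x)) j = charges M1 j" for x
        using regs by (simp add: charges_def)
      have "wp xs m (Cond (b + 3) body Skip) ?post (M1(b + 3 := n - charges M1 j), out1)"
      proof (cases "charges M1 j < n")
        case False
        have "?post (M1(b + 3 := 0), out1)"
          by (rule post) (use skip[OF _ I_upd] False 9 ch in auto)
        then show ?thesis using False by simp
      next
        case True
        have "wp xs m body ?post (M1(b + 3 := n - charges M1 j), out1)"
          by (rule wp_mono[OF body[of j]]) (use I_upd 9 ch True \<open>(V, j) \<in> E\<close> post in auto)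
        with True show ?thesis by simp
      qed
      with True 9 envM1 regs
      show "wp xs m (Cond (b + 3) ?inner Skip) ?post (M1(b + 3 := if (V, j) \<in> E then 1 else 0), out1)"
        by (simp add: charges_def)
    qed
  qed (use that regs env m frame Q in \<open>auto simp: same_def env_def\<close>)
  have "wp xs m (Seq (Const (b + 2) 2) (For b (b + 1) v (Add (b + 2) (b + 2) 2)))
     (wp xs m (For b (b + 1) 2 ?body) Q) (M, out)"
    using env[OF init] M regs by (intro wp_row loop) (auto intro: frame[OF init])
  then show ?thesis by (simp add: nbr_loop_def)
qed

lemma card_less_Suc_if: "card {u. u < Suc j \<and> P u} = card {u. u < j \<and> P u} + (if P j then 1 else 0)"
proof -
  have "{u. u < Suc j \<and> P u} = (if P j then insert j {u. u < j \<and> P u} else {u. u < j \<and> P u})"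
    by (auto simp: less_Suc_eq)
  then show ?thesis by simp
qed

lemma nbrs_alive: "nbrs E (alive n c) v = {u. u < n \<and> (v, u) \<in> E \<and> c u < n}"
  by (auto simp: nbrs_def alive_def)

lemma charges_same: "same R M M' \<Longrightarrow> R \<subseteq> {..<30} \<Longrightarrow> charges M' = charges M"
  by (force simp: same_def charges_def fun_eq_iff)

lemma wp_deg_prog:
  assumes M: "env M" "M v = V" "V < n"
    and regs: "7 \<le> b" "b + 3 < 30" "v \<notin> {b..b + 3}" "r \<notin> {b..b + 3}" "r \<noteq> v" "7 \<le> r" "r < 30"
    and Q: "\<And>M'. same (insert r {b..b + 3}) M M' \<Longrightarrow> M' r = deg E (alive n (charges M)) V \<Longrightarrow> Q (M', out)"
  shows "wp xs m (deg_prog b v r) Q (M, out)"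
proof -
  let ?R = "insert r {b..b + 3}"
  let ?I = "\<lambda>j M' out'. out' = out \<and> same ?R M M' \<and>
     M' r = card {u. u < j \<and> (V, u) \<in> E \<and> charges M u < n}"
  have charges: "charges M' = charges M" if "same ?R M M'" for M'
  proof -
    have "?R \<subseteq> {..<30}" using regs by auto
    then show ?thesis using that by (rule charges_same[rotated])
  qed
  have "wp xs m (nbr_loop b v (Add r r 1)) Q (M(r := 0), out)"
  proof (rule wp_nbr_loop[where I = ?I and V = V], goal_cases)
    case (7 j M1 out1)
    then show ?case using M regs by (auto simp: env_def same_def)
  next
    case (8 j M1 M2 out1)
    then show ?case using regs by (auto simp: same_def)
  next
    case (9 j M1 out1)
    then have "M1 1 = 1" using M regs by (auto simp: env_def same_def)
    with 9 charges[of M1] regs show ?case by (auto simp: same_def card_less_Suc_if)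
  next
    case (10 j M1 out1)
    with charges[of M1] show ?case by (auto simp: card_less_Suc_if)
  next
    case (11 M1 out1)
    then show ?case using Q[of M1] by (simp add: deg_def nbrs_alive)
  qed (use M regs in \<open>auto simp: same_def\<close>)
  then show ?thesis by (simp add: deg_prog_def)
qed

lemma env_same_regs:
  assumes "env M" "same_regs R M M'" "R \<subseteq> {7..}"
  shows "env M'"
proof -
  have "M' r = M r" if "r < 7" for r
  proof -
    have "r \<notin> R" using assms(3) that by auto
    then show ?thesis using assms(2) that by (simp add: same_regs_def)
  qed
  then show ?thesis using assms(1) by (simp add: env_def)
qed

section \<open>The charging phase on the machine\<close>

lemma wp_charge_prog:
  assumes M: "env M" "M 7 = v" "v < n"
    and Q: "\<And>M'. same_regs {11..17} M M' \<Longrightarrow> charges M' = charge E d n v (charges M) \<Longrightarrow> Q (M', out)"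
  shows "wp xs m charge_prog Q (M, out)"
proof -
  define c where "c = charges M"
  define N where "N = nbrs E (alive n c) v"
  let ?upd = "Seq (Add 12 6 14) (Seq (Load 11 12) (Seq (Add 11 11 1) (Seq (Store 12 11) (Add 13 13 1))))"
  let ?loop = "Seq (nbr_loop 14 7 ?upd) (Seq (Add 12 6 7) (Store 12 13))"
  have N: "v \<notin> N" "N = {u. u < n \<and> (v, u) \<in> E \<and> c u < n}"
    using irrefl by (auto simp: N_def nbrs_alive irrefl_def)
  let ?I = "\<lambda>j M' out'. out' = out \<and> same_regs {11..17} M M' \<and>
     M' 13 = c v + card {u. u < j \<and> u \<in> N} \<and>
     charges M' = (\<lambda>u. if u < j \<and> u \<in> N then c u + 1 else c u)"
  have loop: "wp xs m ?loop Q (M', out)"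
    if M': "same_regs {11..17} M M'" "M' 13 = c v" "charges M' = c" "v \<in> alive n c" "2 * d < deg E (alive n c) v" for M'
  proof -
    have "wp xs m (nbr_loop 14 7 ?upd) (wp xs m (Seq (Add 12 6 7) (Store 12 13)) Q) (M', out)"
    proof (rule wp_nbr_loop[where I = ?I and V = v], goal_cases)
      case (7 j M1 out1)
      then show ?case using M by (auto simp: env_def same_regs_def)
    next
      case (8 j M1 M2 out1)
      then have "charges M2 = charges M1" by (intro charges_same) auto
      with 8 show ?case by (auto simp: same_def same_regs_def)
    next
      case (9 j M1 out1)
      then have *: "M1 1 = 1" "M1 6 = 30" using M by (auto simp: env_def same_regs_def)
      \<comment> \<open>Vertex \<open>j\<close> has not been charged yet in this round, so the
        current test agrees with membership in \<open>N\<close>, which was fixed before the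
        loop.\<close>
      have c_j: "charges M1 j = c j" using 9 by simp
      then have cj: "M1 (30 + j) = c j" by (simp add: charges_def)
      moreover have "j \<in> N" using 9 c_j by (simp add: N(2))
      moreover note c_j
      moreover have "charges (M1(12 := x, 11 := y, 30 + j := z, 13 := w)) = (charges M1)(j := z)" for x y z w
        by (auto simp: charges_def fun_eq_iff)
      moreover have "(charges M1)(j := c j + 1) = (\<lambda>u. if u < Suc j \<and> u \<in> N then c u + 1 else c u)"
        using 9 \<open>j \<in> N\<close> by (auto simp: fun_eq_iff less_Suc_eq)
      ultimately show ?case using 9 * by (simp add: same_regs_def card_less_Suc_if)
    next
      case (10 j M1 out1)
      then have "charges M1 j = c j" by simp
      with 10 N(2) have "j \<notin> N" by auto
      then have "charges M1 = (\<lambda>u. if u < Suc j \<and> u \<in> N then c u + 1 else c u)"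
        using 10 by (auto simp: fun_eq_iff less_Suc_eq)
      with 10 \<open>j \<notin> N\<close> show ?case by (simp add: card_less_Suc_if)
    next
      case (11 M1 out1)
      then have *: "M1 6 = 30" "M1 7 = v" using M by (auto simp: env_def same_regs_def)
      have "{u. u < n \<and> u \<in> N} = N" using N by auto
      then have "M1 13 = c v + deg E (alive n c) v" using 11 by (simp add: deg_def N_def)
      moreover have "charges (M1(12 := x, 30 + v := z)) = (charges M1)(v := z)" for x z
        by (auto simp: charges_def fun_eq_iff)
      moreover have "charges M1 = (\<lambda>u. if u \<in> N then c u + 1 else c u)"
        using 11 N(2) by (auto simp: fun_eq_iff)
      ultimately have "charges (M1(12 := 30 + v, 30 + v := M1 13)) = charge E d n v c"
        using M'(4,5) by (auto simp: charge_def fun_eq_iff N_def[symmetric])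
      moreover have "same_regs {11..17} M (M1(12 := 30 + v, 30 + v := M1 13))"
        using 11 by (auto simp: same_regs_def)
      ultimately have "Q (M1(12 := 30 + v, 30 + v := M1 13), out)" by (intro Q) (simp_all add: c_def)
      with 11 * show ?case by simp
    qed (use M M' in \<open>auto simp: same_regs_def\<close>)
    then show ?thesis by simp
  qed
  have skip: "Q (M', out)" if "same_regs {11..17} M M'" "charges M' = c"
    "\<not> (v \<in> alive n c \<and> 2 * d < deg E (alive n c) v)" for M'
    using that by (intro Q) (auto simp: charge_def c_def)
  let ?M = "M(13 := c v, 12 := n - c v)"
  have cM: "charges ?M = c" "M (30 + v) = c v" by (auto simp: c_def charges_def fun_eq_iff)
  have "wp xs m (deg_prog 14 7 12) (wp xs m (Seq (Sub 12 12 4) (Cond 12 ?loop Skip)) Q) (?M, out)" if "c v < n"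
  proof (rule wp_deg_prog[where V = v], goal_cases)
    case (11 M1)
    have sub: "insert 12 {14..14 + 3} \<subseteq> {..<30::nat}" by auto
    have 1: "same_regs {11..17} M M1" "charges M1 = c" "M1 13 = c v" "M1 4 = 2 * d"
      using M charges_same[OF 11(1) sub] cM(1) 11(1) by (auto simp: same_def same_regs_def env_def)
    have 2: "same_regs {11..17} M (M1(12 := x))" "charges (M1(12 := x)) = c" for x
      using 1 by (auto simp: same_regs_def charges_def fun_eq_iff)
    have "v \<in> alive n c" using that M by (simp add: alive_def)
    with 1 2 11(2) cM(1) show ?case
      using loop[of "M1(12 := deg E (alive n c) v - 2 * d)"]
        skip[of "M1(12 := deg E (alive n c) v - 2 * d)"] by simp
  qed (use M in \<open>auto simp: env_def\<close>)
  moreover have "Q (?M, out)" if "\<not> c v < n"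
    using that cM(1) by (intro skip) (auto simp: same_regs_def alive_def)
  moreover have "env M" by fact
  ultimately show ?thesis using M cM(2)
    by (simp add: charge_prog_def env_def)
qed


lemma wp_charge_loop:
  assumes M: "env M" "M 7 = v" "v < n"
    and Q: "\<And>M'. same_regs {9..17} M M' \<Longrightarrow> charges M' = (charge E d n v ^^ n) (charges M) \<Longrightarrow> Q (M', out)"
  shows "wp xs m (For 9 10 2 charge_prog) Q (M, out)"
proof (rule wp_For[where N = n and I = "\<lambda>j M' out'. out' = out \<and> same_regs {9..17} M M' \<and>
    charges M' = (charge E d n v ^^ j) (charges M)"], goal_cases)
  case (9 j M1 out1)
  have M1: "env M1" "M1 7 = v"
    using 9 M env_same_regs[of M "{9..17}" M1] by (auto simp: same_regs_def)
  have "wp xs m charge_prog (\<lambda>(M', out'). M' 9 = j \<and> M' 2 = n \<and> M' 1 = 1 \<and>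
      out' = out \<and> same_regs {9..17} M (M'(9 := Suc j, 10 := n - Suc j)) \<and>
      charges (M'(9 := Suc j, 10 := n - Suc j)) = (charge E d n v ^^ Suc j) (charges M)) (M1, out)"
  proof (rule wp_charge_prog[OF M1 \<open>v < n\<close>])
    fix M' assume M': "same_regs {11..17} M1 M'" "charges M' = charge E d n v (charges M1)"
    have "charges (M'(9 := Suc j, 10 := n - Suc j)) = charges M'" by (simp add: charges_def fun_eq_iff)
    with M' 9 M1(1) show "case (M', out) of (M', out') \<Rightarrow> M' 9 = j \<and> M' 2 = n \<and> M' 1 = 1 \<and>
      out' = out \<and> same_regs {9..17} M (M'(9 := Suc j, 10 := n - Suc j)) \<and>
      charges (M'(9 := Suc j, 10 := n - Suc j)) = (charge E d n v ^^ Suc j) (charges M)"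
      by (auto simp: same_regs_def env_def)
  qed
  with 9 show ?case by simp
qed (use M m Q in \<open>auto simp: same_regs_def env_def charges_def fun_eq_iff\<close>)

lemma wp_charge_all:
  assumes M: "env M"
    and Q: "\<And>M'. same_regs {7..17} M M' \<Longrightarrow> charges M' = charge_all E d n (charges M) \<Longrightarrow> Q (M', out)"
  shows "wp xs m (For 7 8 2 (For 9 10 2 charge_prog)) Q (M, out)"
proof (rule wp_For[where N = n and I = "\<lambda>j M' out'. out' = out \<and> same_regs {7..17} M M' \<and>
    charges M' = fold (\<lambda>v. charge E d n v ^^ n) [0..<j] (charges M)"], goal_cases)
  case (9 j M1 out1)
  have M1: "env M1" using 9 M env_same_regs[of M "{7..17}" M1] by auto
  have "wp xs m (For 9 10 2 charge_prog) (\<lambda>(M', out'). M' 7 = j \<and> M' 2 = n \<and> M' 1 = 1 \<and>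
      out' = out \<and> same_regs {7..17} M (M'(7 := Suc j, 8 := n - Suc j)) \<and>
      charges (M'(7 := Suc j, 8 := n - Suc j)) = fold (\<lambda>v. charge E d n v ^^ n) [0..<Suc j] (charges M)) (M1, out)"
  proof (rule wp_charge_loop[OF M1 \<open>M1 7 = j\<close> \<open>j < n\<close>])
    fix M' assume M': "same_regs {9..17} M1 M'" "charges M' = (charge E d n j ^^ n) (charges M1)"
    have "charges (M'(7 := Suc j, 8 := n - Suc j)) = charges M'" by (simp add: charges_def fun_eq_iff)
    with M' 9 M1(1) show "case (M', out) of (M', out') \<Rightarrow> M' 7 = j \<and> M' 2 = n \<and> M' 1 = 1 \<and>
      out' = out \<and> same_regs {7..17} M (M'(7 := Suc j, 8 := n - Suc j)) \<and>
      charges (M'(7 := Suc j, 8 := n - Suc j)) = fold (\<lambda>v. charge E d n v ^^ n) [0..<Suc j] (charges M)"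
      by (auto simp: same_regs_def env_def)
  qed
  with 9 show ?case by simp
next
  case (10 M1 out1)
  then show ?case using Q by (simp add: charge_all_def)
qed (use M m in \<open>auto simp: same_regs_def env_def charges_def fun_eq_iff\<close>)

section \<open>The greedy phase on the machine\<close>

lemma wp_pick_prog:
  assumes M: "env M" "M 9 = u" "u < n" "M 11 = \<tau> - 1" "\<tau> > 0"
    and Q: "\<And>M'. same_regs {12..21} M M' \<Longrightarrow> charges M' = pick E d n \<tau> u (charges M) \<Longrightarrow> Q (M', out)"
  shows "wp xs m pick_prog Q (M, out)"
proof -
  define c where "c = charges M"
  define A where "A = alive n c"
  let ?test = "Seq (deg_prog 18 14 12) (Seq (Sub 12 12 3) (Cond 12 (Add 13 13 1) Skip))"
  let ?remove = "Seq (Sub 13 13 11) (Cond 13 (Seq (Add 12 6 9) (Store 12 2)) Skip)"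
  let ?P = "\<lambda>v. v \<in> nbrs E A u \<and> d < deg E A v"
  let ?I = "\<lambda>j M' out'. out' = out \<and> same {12..21} M M' \<and>
     M' 13 = deg E A u - d + card {v. v < j \<and> ?P v}"
  have charges: "charges M' = c" if "same {12..21} M M'" for M'
    unfolding c_def using that by (rule charges_same) auto
  have env': "env M' \<and> M' 9 = u \<and> M' 11 = \<tau> - 1" if "same {12..21} M M'" for M'
    using that M by (simp add: same_def env_def)
  have final: "wp xs m ?remove Q (M', out)"
    if M': "same {12..21} M M'" "M' 13 = cov E d A u" and u: "u \<in> A" for M'
  proof -
    let ?M1 = "M'(13 := cov E d A u - (\<tau> - 1))"
    let ?M2 = "?M1(12 := 30 + u, 30 + u := n)"
    have "charges ?M1 = c" using charges[OF M'(1)] by (auto simp: charges_def fun_eq_iff)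
    moreover from this have "charges ?M2 = c(u := n)" by (auto simp: charges_def fun_eq_iff)
    moreover have "same_regs {12..21} M ?M1" "same_regs {12..21} M ?M2"
      using M'(1) by (auto simp: same_def same_regs_def)
    moreover have "\<tau> \<le> cov E d A u \<longleftrightarrow> cov E d A u - (\<tau> - 1) \<noteq> 0" using M(5) by auto
    ultimately have "if cov E d A u - (\<tau> - 1) \<noteq> 0 then Q (?M2, out) else Q (?M1, out)"
      using u Q[of ?M2] Q[of ?M1] by (auto simp: pick_def A_def c_def)
    with env'[OF M'(1)] M'(2) show ?thesis
      by (cases "cov E d A u - (\<tau> - 1) = 0") (simp_all add: env_def)
  qed
  have loop: "wp xs m (nbr_loop 14 9 ?test) (wp xs m ?remove Q) (M', out)"
    if M': "same {12..21} M M'" "M' 13 = deg E A u - d" and u: "u \<in> A" for M'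
  proof (rule wp_nbr_loop[where I = ?I and V = u], goal_cases)
    case (7 j M1 out1)
    then show ?case using env' by auto
  next
    case (8 j M1 M2 out1)
    then show ?case by (auto simp: same_def)
  next
    case (9 j M1 out1)
    then have M1: "same {12..21} M M1" "charges M1 = c" "env M1" using charges env' by auto
    have j: "j \<in> nbrs E A u" using 9 M1 by (simp add: nbrs_alive A_def)
    have out1: "out1 = out" using 9 by simp
    show ?case unfolding wp.simps out1
    \<comment> \<open>The nested degree computation works in registers 18 to 21, so counter 14 and
      row address 16 of the outer loop survive.\<close>
    proof (rule wp_deg_prog[OF \<open>env M1\<close> \<open>M1 14 = j\<close> \<open>j < n\<close>], goal_cases)
      case (8 M2)
      have "same {12..21} M M2" using 8(1) M1(1) by (auto simp: same_def)
      then have *: "same {12..21} M (M2(12 := x, 13 := y))" "same {12..21} M (M2(12 := x))" for x y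
        by (auto simp: same_def)
      have eqs: "M2 13 = M1 13" "M2 14 = j" "M2 16 = M1 16" "M2 3 = d" "M2 1 = 1"
        using 8(1) M1(3) 9 by (auto simp: same_def env_def)
      have deg: "M2 12 = deg E A j" using 8(2) M1(2) by (simp add: A_def)
      have card: "card {v. v < Suc j \<and> ?P v} = card {v. v < j \<and> ?P v} + (if d < deg E A j then 1 else 0)"
        using j by (simp add: card_less_Suc_if)
      show ?case using 9 eqs deg * card by (cases "d < deg E A j") simp_all
    qed auto
  next
    case (10 j M1 out1)
    then have "charges M1 = c" using charges by auto
    with 10 have "j \<notin> nbrs E A u" by (auto simp: nbrs_alive A_def)
    with 10 show ?case by (simp add: card_less_Suc_if)
  next
    case (11 M1 out1)
    have "{v. v < n \<and> ?P v} = {v \<in> nbrs E A u. d < deg E A v}" by (auto simp: nbrs_alive A_def)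
    with 11 have "M1 13 = cov E d A u" by (simp add: cov_def)
    with 11 final[OF _ _ u] show ?case by blast
  qed (use env'[OF M'(1)] M M' in auto)
  have skip: "Q (M', out)" if "same_regs {12..21} M M'" "charges M' = c" "u \<notin> A" for M'
    using that by (intro Q) (auto simp: pick_def c_def A_def)
  let ?M = "M(12 := n - c u)"
  have cM: "charges ?M = c" "M (30 + u) = c u" by (auto simp: c_def charges_def fun_eq_iff)
  have "wp xs m (deg_prog 14 9 13) (wp xs m (Seq (Sub 13 13 3) (Seq (nbr_loop 14 9 ?test) ?remove)) Q) (?M, out)"
    if "c u < n"
  proof (rule wp_deg_prog[where V = u], goal_cases)
    case (11 M1)
    have sub: "insert 13 {14..14 + 3} \<subseteq> {..<30::nat}" by auto
    have "same {12..21} M M1" using 11(1) by (auto simp: same_def)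
    then have 1: "same {12..21} M (M1(13 := x))" "M1 3 = d" for x
      using M by (auto simp: same_def env_def)
    have "u \<in> A" using that M by (simp add: A_def alive_def)
    moreover have "M1 13 = deg E A u" using 11(2) by (simp only: cM A_def)
    ultimately show ?case using loop[OF 1(1)] 1(2) by simp
  qed (use M in \<open>auto simp: env_def\<close>)
  moreover have "Q (?M, out)" if "\<not> c u < n"
    using that cM(1) by (intro skip) (auto simp: same_regs_def A_def alive_def)
  ultimately show ?thesis using M cM(2)
    by (simp add: pick_prog_def env_def)
qed

text \<open>Register 11 is exempt from the changes because it carries the threshold through the
  whole pass.\<close>

lemma wp_pick_pass:
  assumes M: "env M" "M 11 = \<tau> - 1" "\<tau> > 0"
    and Q: "\<And>M'. same_regs ({9..21} - {11}) M M' \<Longrightarrow> charges M' = pick_pass E d n \<tau> (charges M) \<Longrightarrow> Q (M', out)"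
  shows "wp xs m (For 9 10 2 pick_prog) Q (M, out)"
proof (rule wp_For[where N = n and I = "\<lambda>j M' out'. out' = out \<and> same_regs ({9..21} - {11}) M M' \<and>
    charges M' = fold (pick E d n \<tau>) [0..<j] (charges M)"], goal_cases)
  case (9 j M1 out1)
  have "{9..21} - {11} \<subseteq> {7::nat..}" by auto
  then have M1: "env M1" "M1 11 = \<tau> - 1"
    using 9 M env_same_regs[of M "{9..21} - {11}" M1] by (simp_all add: same_regs_def)
  have "wp xs m pick_prog (\<lambda>(M', out'). M' 9 = j \<and> M' 2 = n \<and> M' 1 = 1 \<and>
      out' = out \<and> same_regs ({9..21} - {11}) M (M'(9 := Suc j, 10 := n - Suc j)) \<and>
      charges (M'(9 := Suc j, 10 := n - Suc j)) = fold (pick E d n \<tau>) [0..<Suc j] (charges M)) (M1, out)"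
  proof (rule wp_pick_prog[OF M1(1) \<open>M1 9 = j\<close> \<open>j < n\<close> M1(2) \<open>\<tau> > 0\<close>])
    fix M' assume M': "same_regs {12..21} M1 M'" "charges M' = pick E d n \<tau> j (charges M1)"
    have "charges (M'(9 := Suc j, 10 := n - Suc j)) = charges M'" by (simp add: charges_def fun_eq_iff)
    with M' 9 M1(1) show "case (M', out) of (M', out') \<Rightarrow> M' 9 = j \<and> M' 2 = n \<and> M' 1 = 1 \<and>
      out' = out \<and> same_regs ({9..21} - {11}) M (M'(9 := Suc j, 10 := n - Suc j)) \<and>
      charges (M'(9 := Suc j, 10 := n - Suc j)) = fold (pick E d n \<tau>) [0..<Suc j] (charges M)"
      by (auto simp: same_regs_def env_def)
  qed
  with 9 show ?case by simp
next
  case (10 M1 out1)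
  then show ?case using Q by (simp add: pick_pass_def)
qed (use M m in \<open>auto simp: same_regs_def env_def charges_def fun_eq_iff\<close>)

lemma wp_greedy:
  assumes M: "env M"
    and Q: "\<And>M'. same_regs {7..21} M M' \<Longrightarrow> charges M' = greedy E d n (charges M) \<Longrightarrow> Q (M', out)"
  shows "wp xs m (For 7 8 5 (Seq (Sub 11 5 7) (Seq (Sub 11 11 1) (For 9 10 2 pick_prog)))) Q (M, out)"
proof (rule wp_For[where N = "2 * n" and I = "\<lambda>j M' out'. out' = out \<and> same_regs {7..21} M M' \<and>
    charges M' = fold (\<lambda>a. pick_pass E d n (2 * n - a)) [0..<j] (charges M)"], goal_cases)
  case (9 j M1 out1)
  have M1: "env M1" using 9 M env_same_regs[of M "{7..21}" M1] by auto
  let ?M = "M1(11 := 2 * n - j - 1)"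
  have env: "env ?M" "?M 11 = 2 * n - j - 1" "2 * n - j > 0" using M1 9 by (auto simp: env_def)
  have ch: "charges ?M = charges M1" by (simp add: charges_def fun_eq_iff)
  have "wp xs m (For 9 10 2 pick_prog) (\<lambda>(M', out'). M' 7 = j \<and> M' 5 = 2 * n \<and> M' 1 = 1 \<and>
      out' = out \<and> same_regs {7..21} M (M'(7 := Suc j, 8 := 2 * n - Suc j)) \<and>
      charges (M'(7 := Suc j, 8 := 2 * n - Suc j))
        = fold (\<lambda>a. pick_pass E d n (2 * n - a)) [0..<Suc j] (charges M)) (?M, out)"
  proof (rule wp_pick_pass[OF env])
    fix M' assume M': "same_regs ({9..21} - {11}) ?M M'" "charges M' = pick_pass E d n (2 * n - j) (charges ?M)"
    have "charges (M'(7 := Suc j, 8 := 2 * n - Suc j)) = charges M'" by (simp add: charges_def fun_eq_iff)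
    moreover have "same_regs {7..21} M (M'(7 := Suc j, 8 := 2 * n - Suc j))"
      using M'(1) 9 by (auto simp: same_regs_def)
    ultimately show "case (M', out) of (M', out') \<Rightarrow> M' 7 = j \<and> M' 5 = 2 * n \<and> M' 1 = 1 \<and>
      out' = out \<and> same_regs {7..21} M (M'(7 := Suc j, 8 := 2 * n - Suc j)) \<and>
      charges (M'(7 := Suc j, 8 := 2 * n - Suc j))
        = fold (\<lambda>a. pick_pass E d n (2 * n - a)) [0..<Suc j] (charges M)"
      using M' 9 M1(1) ch by (simp add: same_regs_def env_def)
  qed
  with 9 M1 show ?case by (simp add: env_def)
next
  case (10 M1 out1)
  then show ?case using Q by (simp add: greedy_def)
qed (use M m in \<open>auto simp: same_regs_def env_def charges_def fun_eq_iff\<close>)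

section \<open>Output and the complete program\<close>

lemma wp_output:
  assumes M: "env M"
    and Q: "\<And>M' ys. set ys = {..<n} - alive n (charges M) \<Longrightarrow> Q (M', ys)"
  shows "wp xs m (For 9 10 2 (Seq (Add 12 6 9) (Seq (Load 12 12) (Seq (Sub 12 2 12) (Cond 12 Skip (Write 9))))))
    Q (M, [])"
proof (rule wp_For[where N = n and I = "\<lambda>j M' out'. same_regs {9,10,12} M M' \<and> charges M' = charges M \<and>
    set out' = {..<j} - alive n (charges M)"], goal_cases)
  case (9 j M1 out1)
  have M1: "M1 1 = 1" "M1 2 = n" "M1 6 = 30"
    using 9 M env_same_regs[of M "{9,10,12}" M1] by (auto simp: env_def)
  have "M1 (30 + j) = charges M j" using 9 by (auto simp: charges_def fun_eq_iff)
  moreover have "charges (M1(12 := x, 9 := y, 10 := z)) = charges M" for x y z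
    using 9 by (auto simp: charges_def fun_eq_iff)
  moreover have "same_regs {9,10,12} M (M1(12 := x, 9 := y, 10 := z))" for x y z
    using 9 by (auto simp: same_regs_def)
  moreover have "{..<Suc j} - alive n (charges M)
      = (if charges M j < n then {..<j} - alive n (charges M) else insert j ({..<j} - alive n (charges M)))"
    using 9(1) by (auto simp: alive_def less_Suc_eq)
  ultimately show ?case using 9 M1 by auto
qed (use M m Q in \<open>auto simp: same_regs_def env_def charges_def fun_eq_iff\<close>)

lemma wp_star_prog:
  assumes k: "length xs \<ge> 2" "xs ! 0 = n" "xs ! 1 - 2 = d"
    and Q: "\<And>M ys. set ys = {..<n} - alive n (final_charges E d n) \<Longrightarrow> Q (M, ys)"
  shows "wp xs m star_prog Q ((\<lambda>_. 0), [])"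
proof -
  let ?M = "(\<lambda>_. 0)(1 := 1, 2 := n, 3 := d, 4 := 2 * d, 5 := 2 * n, 6 := 30)"
  have init: "env ?M" "charges ?M = (\<lambda>_. 0)" by (auto simp: env_def charges_def fun_eq_iff)
  have rest: "wp xs m (Seq (For 7 8 2 (For 9 10 2 charge_prog))
       (Seq (For 7 8 5 (Seq (Sub 11 5 7) (Seq (Sub 11 11 1) (For 9 10 2 pick_prog))))
       (For 9 10 2 (Seq (Add 12 6 9) (Seq (Load 12 12) (Seq (Sub 12 2 12) (Cond 12 Skip (Write 9)))))))) Q (?M, [])"
    unfolding wp.simps(9)
  proof (rule wp_charge_all[OF init(1)], rule wp_greedy, goal_cases)
    case (1 M1)
    then show ?case using env_same_regs[OF init(1)] by auto
  next
    case (2 M1 M2)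
    have "env M1" using env_same_regs[OF init(1) 2(1)] by auto
    then have "env M2" using env_same_regs[OF _ 2(3)] by auto
    then show ?case
      by (rule wp_output) (use 2 init(2) Q in \<open>simp add: final_charges_def\<close>)
  qed
  have "wp xs m init_prog P ((\<lambda>_. 0), []) = P (?M, [])" for P
  proof -
    have "xs \<noteq> []" using k(1) by auto
    then show ?thesis using k by (simp add: init_prog_def mult_2)
  qed
  with rest show ?thesis by (simp only: star_prog_def wp.simps(9))
qed

end

section \<open>Star transversals and bounded degree\<close>

text \<open>The centre of a star has its \<open>k - 1\<close> leaves as neighbours; conversely, a
  vertex with that many neighbours is the centre of such a star. By \<open>k \<ge> 2\<close>,
  exceeding \<open>k - 2\<close> means reaching \<open>k - 1\<close> in spite of truncated
  subtraction.\<close>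

lemma star_transversal_iff_bounded_deg:
  assumes "pair_graph G" "k \<ge> 2"
  shows "star_transversal k (with_proj G) F \<longleftrightarrow>
    F \<subseteq> pverts G \<and> bounded_deg (parcs G) (k - 2) (pverts G - F)"
proof -
  interpret pair_graph G by fact
  let ?S = "pverts G - F"
  let ?G' = "with_proj G \<restriction> ?S"
  have fin: "finite ?S" using pair_finite_verts by simp
  have wf: "wf_digraph ?G'" by unfold_locales auto
  have "(\<exists>H. subgraph H ?G' \<and> K\<^bsub>1,k - 1\<^esub> H) \<longleftrightarrow> \<not> bounded_deg (parcs G) (k - 2) ?S"
  proof
    assume "\<exists>H. subgraph H ?G' \<and> K\<^bsub>1,k - 1\<^esub> H"
    then obtain H U L where H: "subgraph H ?G'" "verts H = U \<union> L" "card U = 1" "card L = k - 1"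
      "arcs_ends H = U \<times> L \<union> L \<times> U"
      unfolding complete_bipartite_digraph_def by blast
    then obtain v where v: "U = {v}" using card_1_singletonE by blast
    have ends: "tail H = fst" "head H = snd" "arcs H \<subseteq> {e \<in> parcs G. fst e \<in> ?S \<and> snd e \<in> ?S}"
      "v \<in> ?S"
      using H(1,2) v by (auto simp: subgraph_def compatible_def induce_subgraph_def)
    have "L \<subseteq> nbrs (parcs G) ?S v"
    proof
      fix l assume "l \<in> L"
      then have "(v, l) \<in> arcs_ends H" using H(5) v by simp
      then obtain e where "e \<in> arcs H" "fst e = v" "snd e = l"
        by (auto simp: arcs_ends_def arc_to_ends_def ends)
      with ends(3) show "l \<in> nbrs (parcs G) ?S v" by (auto simp: nbrs_def)
    qed
    from card_mono[OF finite_nbrs[OF fin] this] have "k - 1 \<le> deg (parcs G) ?S v"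
      by (simp add: deg_def H(4))
    with ends(4) assms(2) show "\<not> bounded_deg (parcs G) (k - 2) ?S"
      by (force simp: bounded_deg_def)
  next
    assume "\<not> bounded_deg (parcs G) (k - 2) ?S"
    then obtain v where v: "v \<in> ?S" "k - 1 \<le> card (nbrs (parcs G) ?S v)"
      using assms(2) by (force simp: bounded_deg_def deg_def)
    then obtain L where L: "L \<subseteq> nbrs (parcs G) ?S v" "card L = k - 1" "finite L"
      by (meson obtain_subset_with_card_n)
    \<comment> \<open>The star on \<open>v\<close> and \<open>L\<close>, with both orientations of
      each edge; absence of loops keeps its two sides disjoint.\<close>
    define H where "H = \<lparr>pverts = {v} \<union> L, parcs = {v} \<times> L \<union> L \<times> {v}\<rparr>"
    have "v \<notin> L" using L(1) no_loops' by (auto simp: nbrs_def)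
    then have K: "K\<^bsub>1,k - 1\<^esub> (with_proj H)"
      unfolding complete_bipartite_digraph_pair_def using L
      by (intro conjI exI[of _ "{v}"] exI[of _ L]) (auto simp: H_def)
    have "wf_digraph (with_proj H)" by unfold_locales (auto simp: H_def)
    moreover have "verts (with_proj H) \<subseteq> ?S" using v L(1) by (auto simp: H_def nbrs_def)
    moreover have "arcs (with_proj H) \<subseteq> arcs ?G'"
      using v L(1) by (auto simp: H_def nbrs_def induce_subgraph_def intro: arcs_symmetric)
    ultimately have "subgraph (with_proj H) ?G'"
      using wf by (simp add: subgraph_def compatible_def induce_subgraph_def)
    with K show "\<exists>H. subgraph H ?G' \<and> K\<^bsub>1,k - 1\<^esub> H" by blast
  qed
  then show ?thesis unfolding star_transversal_def with_proj_simps by blast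
qed

lemma opt_star_transversal_attained:
  assumes "star_transversal k G F"
  shows "\<exists>X. star_transversal k G X \<and> card X = opt_star_transversal k G"
  unfolding opt_star_transversal_def by (rule LeastI_ex) (use assms in blast)

section \<open>Row-major layout of the adjacency matrix\<close>

lemma length_concat_rows: "length (concat (map (\<lambda>i. map (f i) [0..<n]) [0..<r])) = r * n"
  by (induction r) auto

lemma nth_concat_rows:
  "u < r \<Longrightarrow> v < n \<Longrightarrow> concat (map (\<lambda>i. map (f i) [0..<n]) [0..<r]) ! (u * n + v) = f u v"
proof (induction r)
  case (Suc r)
  show ?case
  proof (cases "u < r")
    case True
    then have "u * n + n \<le> r * n" by (metis Suc_leI add.commute mult_Suc mult_le_mono1)
    with Suc True show ?thesis
      by (simp add: nth_append length_concat_rows)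
  next
    case False
    with Suc.prems have "u = r" by simp
    with Suc.prems show ?thesis by (simp add: nth_append length_concat_rows)
  qed
qed simp

text \<open>Entries 0 count as one bit too, so the size dominates the number of entries and thereby
  the loop bounds.\<close>

lemma length_le_input_size: "length xs \<le> input_size xs"
  by (induction xs) (auto simp: input_size_def)

text \<open>Induction, using that the increment of \<open>ln\<close> from \<open>N\<close> to
  \<open>N + 1\<close> is at least \<open>1 / (N + 1)\<close>.\<close>

lemma harmonic_sum_le: "N > 0 \<Longrightarrow> (\<Sum>s\<in>{1..N}. 1 / real s) \<le> 1 + ln (real N)"
proof (induction N rule: nat_induct_non_zero)
  case (Suc N)
  have "ln (real N) - ln (real (Suc N)) \<le> (real N - real (Suc N)) / real (Suc N)"
    using Suc.hyps by (intro ln_diff_le) auto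
  also have "\<dots> = - (1 / real (Suc N))" by (simp add: field_simps)
  finally show ?case using Suc.IH by simp
qed simp

lemma ratio_bigo: "(\<lambda>k. ratio (k - 2)) \<in> O(\<lambda>k. ln (real k))"
proof (rule bigoI[where c = 13])
  have "norm (ratio (k - 2)) \<le> 13 * norm (ln (real k))" if "k \<ge> 3" for k
  proof -
    \<comment> \<open>The cutoff 3 is chosen so that \<open>ln k \<ge> 1\<close>, which lets the
      logarithm absorb additive constants.\<close>
    have "exp 1 \<le> real k" using exp_le that by linarith
    then have ln1: "1 \<le> ln (real k)" using that by (subst ln_ge_iff) auto
    have "ratio (k - 2) \<le> 10 + ln (real (3 * (k - 2)))"
      using harmonic_sum_le[of "3 * (k - 2)"] that by (simp add: ratio_def)
    also have "\<dots> \<le> 10 + ln (3 * real k)" using that by simp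
    also have "\<dots> = 10 + ln 3 + ln (real k)" using that by (simp add: ln_mult)
    \<comment> \<open>Since \<open>ln 3 \<le> 2\<close>, the constants sum to at most 12.\<close>
    also have "\<dots> \<le> 13 * ln (real k)" using ln1 ln_le_minus_one[of "3 :: real"] by simp
    finally have "ratio (k - 2) \<le> 13 * ln (real k)" .
    moreover have "0 \<le> ratio (k - 2)" unfolding ratio_def by (intro add_nonneg_nonneg sum_nonneg) auto
    ultimately show ?thesis using ln1 by simp
  qed
  then show "\<forall>\<^sub>F k in at_top. norm (ratio (k - 2)) \<le> 13 * norm (ln (real k))"
    using eventually_ge_at_top[of "3 :: nat"] by (rule eventually_mono[rotated])
qed

lemma star_prog_correct:
  assumes "(k, G) \<in> star_instances"
  defines "xs \<equiv> encode_instance (k, G)"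
  shows "\<exists>t M ys. exec xs star_prog ((\<lambda>_. 0), []) t (M, ys) \<and>
    t \<le> cost (2 * input_size xs) star_prog \<and> approx_star_transversal (\<lambda>k. ratio (k - 2)) (k, G) ys"
proof -
  from assms obtain n where k: "k \<ge> 2" and "pair_graph G" and n: "pverts G = {..<n}"
    by (auto simp: star_instances_def)
  then interpret pair_graph G by simp
  note iff = star_transversal_iff_bounded_deg[OF \<open>pair_graph G\<close> k]
  have E: "sym (parcs G)" "irrefl (parcs G)"
    using arcs_symmetric no_loops' by (auto simp: sym_def irrefl_def)
  have xs: "xs = n # k # concat (map (\<lambda>i. map (\<lambda>j. if (i, j) \<in> parcs G then 1 else 0) [0..<n]) [0..<n])"
    by (simp add: xs_def encode_instance_def n)
  have len: "length xs = 2 + n * n" by (simp add: xs length_concat_rows)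
  \<comment> \<open>The input contains the \<open>n * n\<close> matrix entries, so \<open>n\<close>
    is bounded by the input size even though its own entry is short.\<close>
  have "n \<le> n * n" by simp
  then have size: "2 * n \<le> 2 * input_size xs" using length_le_input_size[of xs] len by linarith
  interpret ram xs n "k - 2" "2 * input_size xs" "parcs G"
  proof
    fix u v assume uv: "u < n" "v < n"
    then have "u * n + n \<le> n * n" by (metis Suc_leI add.commute mult_Suc mult_le_mono1)
    then have "2 + u * n + v < length xs" using uv len by linarith
    then show "(if 2 + u * n + v < length xs then xs ! (2 + u * n + v) else 0) = (if (u, v) \<in> parcs G then 1 else 0)"
      using nth_concat_rows[OF uv, of "\<lambda>i j. if (i, j) \<in> parcs G then 1 else 0"] by (simp add: xs)
  qed (use size E(2) in auto)
  \<comment> \<open>The yardstick \<open>X\<close> is now an optimal transversal; one exists because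
    deleting all vertices is feasible.\<close>
  let ?A = "alive n (final_charges (parcs G) (k - 2) n)"
  have "star_transversal k (with_proj G) (pverts G)"
    unfolding iff by (simp add: bounded_deg_def)
  then obtain X where X: "star_transversal k (with_proj G) X" "card X = opt_star_transversal k (with_proj G)"
    using opt_star_transversal_attained by blast
  then have "X \<subseteq> {..<n}" "bounded_deg (parcs G) (k - 2) ({..<n} - X)"
    by (simp_all add: iff n)
  note correct = final_charges_correct[OF E this]
  have "approx_star_transversal (\<lambda>k. ratio (k - 2)) (k, G) ys" if "set ys = {..<n} - ?A" for ys
  proof -
    have "{..<n} - ({..<n} - ?A) = ?A" using alive_subset by blast
    then show ?thesis
      using correct X(2) by (simp add: approx_star_transversal_def iff n that)
  qed
  then have "wp xs (2 * input_size xs) star_prog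
      (\<lambda>(M, ys). approx_star_transversal (\<lambda>k. ratio (k - 2)) (k, G) ys) ((\<lambda>_. 0), [])"
    by (intro wp_star_prog) (auto simp: xs)
  from wp_sound[OF this] show ?thesis by fastforce
qed

theorem theorem2:
  shows "\<exists>(\<rho> :: nat \<Rightarrow> real) c.
    \<rho> \<in> O(\<lambda>k. ln (real k)) \<and>
    solves_in_poly_time c star_instances encode_instance (approx_star_transversal \<rho>)"
proof -
  obtain p where p: "\<forall>m. cost m star_prog = poly p m" using cost_poly by blast
  have "solves_in_poly_time star_prog star_instances encode_instance
      (approx_star_transversal (\<lambda>k. ratio (k - 2)))"
    unfolding solves_in_poly_time_def
  \<comment> \<open>Loops are bounded by twice the input size, so \<open>p\<close> is composed with
    the polynomial \<open>2 * x\<close>.\<close>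
  proof (intro exI[of _ "pcompose p [:0, 2:]"] ballI)
    fix i assume i: "i \<in> star_instances"
    obtain k G where "i = (k, G)" by fastforce
    with star_prog_correct[of k G] i p
    show "\<exists>t M ys. exec (encode_instance i) star_prog ((\<lambda>_. 0), []) t (M, ys) \<and>
        t \<le> poly (pcompose p [:0, 2:]) (input_size (encode_instance i)) \<and>
        approx_star_transversal (\<lambda>k. ratio (k - 2)) i ys"
      by (simp add: poly_pcompose mult.commute)
  qed
  with ratio_bigo show ?thesis by blast
qed

end
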